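(* There are an absolute constant $c>0$ and, for each $n$, a constant $C_n>0$ depending only on $n$ such that the following holds. Let $F \subset \mathbb{Z}^2$ be a finite set, and let $E \subset \mathbb{Z}^2$ be an $\ell\mathbb{Z}^2$-periodic set for some integer $\ell \ge 1$. If there is at least one tiling $A$ of $E$ by $F$ (a set $A\subset\mathbb{Z}^2$ with $\mathbf{1}_F * \mathbf{1}_A = \mathbf{1}_E$), then there exist a positive integer $M$ and a tiling $A'$ of $E$ by $F$ (so $\mathbf{1}_F * \mathbf{1}_{A'} = \mathbf{1}_E$) such that $A'$ is $\ell M\mathbb{Z}^2$-periodic and $$M \le C_{|F|}\, \mathrm{diam}(F)^{c|F|^4},$$ where for $|F| \le 1$ the bound is to be read as $M \le C_{|F|}$.
   Context: $\mathbf{1}_S$ is the indicator function of $S$; $f*g(x) = \sum_{y \in \mathbb{Z}^2} f(y)g(x-y)$. A set $S\subset \mathbb{Z}^2$ is $\Gamma$-periodic, for a subgroup $\Gamma \le \mathbb{Z}^2$, if $\mathbf{1}_S(x+\gamma) = \mathbf{1}_S(x)$ for all $x\in\mathbb{Z}^2$, $\gamma \in \Gamma$. $\mathrm{diam}(F)$ is the Euclidean diameter of $F$. *)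

theory Defs
  imports "HOL-Analysis.Analysis"
begin

type_synonym Z2 = "int \<times> int"

text \<open>
  Convolution on the group \<open>\<int>\<^sup>2\<close>. The sum is a genuine (finite) sum whenever \<open>f\<close> is finitely
  supported, which is the only case of interest here.
\<close>

definition conv :: "(Z2 \<Rightarrow> real) \<Rightarrow> (Z2 \<Rightarrow> real) \<Rightarrow> Z2 \<Rightarrow> real" where
  "conv f g x = (\<Sum>\<^sub>\<infinity>y. f y * g (x - y))"

definition tiling :: "Z2 set \<Rightarrow> Z2 set \<Rightarrow> Z2 set \<Rightarrow> bool" where
  "tiling F A E \<longleftrightarrow> conv (indicator F) (indicator A) = indicator E"

text \<open>Only used when \<open>\<Gamma>\<close> is a subgroup of \<open>\<int>\<^sup>2\<close>.\<close>

definition periodic :: "Z2 set \<Rightarrow> Z2 set \<Rightarrow> bool" where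
  "periodic \<Gamma> S \<longleftrightarrow>
     (\<forall>x. \<forall>\<gamma>\<in>\<Gamma>. (indicator S (x + \<gamma>) :: real) = indicator S x)"

definition scaled_lattice :: "int \<Rightarrow> Z2 set" where
  "scaled_lattice l = {(l * a, l * b) | a b. True}"

text \<open>The metric on \<open>real \<times> real\<close> is the Euclidean one.\<close>

definition diam :: "Z2 set \<Rightarrow> real" where
  "diam F = diameter ((\<lambda>(a, b). (real_of_int a, real_of_int b)) ` F)"

end

theory Submission
  imports Defs "HOL-Library.Poly_Mapping" "HOL-Complex_Analysis.Great_Picard"
begin

text \<open>If \<open>F\<close> has at most one element, the empty set or a translate of \<open>E\<close> is a tiling with the period of \<open>E\<close>.
  Let \<open>F\<close> have \<open>n \<ge> 2\<close> elements, fix \<open>f\<^sub>0 \<in> F\<close>, and let \<open>A\<close> be a tiling of the \<open>l\<close>-periodic set \<open>E\<close>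
  by \<open>F\<close>. A structured description of \<open>A\<close> is derived first; then \<open>A\<close> is changed, line by line, into a
  periodic tiling.

  \<^bold>\<open>Dilation and averaging.\<close> Modulo a prime \<open>p\<close>, the \<open>p\<close>-th power of a sum of translations is the sum of
  the \<open>p\<close>-fold translations. For \<open>p > n\<close> the resulting congruences are between numbers that are too
  small to be congruent without being equal, so \<open>A\<close> is also a tiling of \<open>E\<close> by \<open>r F\<close> for all
  \<open>r \<equiv> 1\<close> modulo \<open>L = l n!\<close> (lemma \<open>dilation\<close>). Averaging over these \<open>r\<close> (lemma \<open>averaging\<close>) expresses the
  indicator of \<open>E - f\<^sub>0\<close> as the indicator of \<open>A\<close> plus functions \<open>\<phi>\<^sub>f\<close>, for \<open>f \<noteq> f\<^sub>0\<close>, with values in \<open>[0, 1]\<close>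
  and period \<open>L (f - f\<^sub>0)\<close>. Merging parallel directions leaves functions \<open>\<phi>\<^sub>w\<close> of period \<open>L w\<close>, with
  \<open>w\<close> in a finite set \<open>U\<close> of pairwise non-parallel vectors.

  \<^bold>\<open>Weak periodicity.\<close> Let \<open>\<Delta>\<close> be a common multiple of the determinants of pairs in \<open>U\<close>. Inside a coset
  of \<open>L \<Delta> \<int>\<^sup>2\<close>, values of \<open>\<phi>\<^sub>w\<close> and \<open>\<phi>\<^sub>w\<^sub>'\<close> at any two points can be transported to one common point, so
  they add up to at most 1 and at most one \<open>\<phi>\<^sub>w\<close> exceeds \<open>1/2\<close>. Difference operators show that each
  \<open>\<phi>\<^sub>w\<close> is a polynomial modulo 1 along progressions with steps in \<open>L \<Delta> \<int>\<^sup>2\<close>, and a polynomial with values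
  in \<open>[0, 1/2]\<close> cannot be equidistributed; a Weyl theorem with uniform denominators (theorem \<open>weyl\<close>)
  makes it periodic modulo 1 with a period \<open>C\<close> that depends only on \<open>n\<close>. The exceptional \<open>\<phi>\<^sub>w\<close> inherits
  this, since the \<open>\<phi>\<^sub>w\<close> add up to an integer. Hence all \<open>\<phi>\<^sub>w\<close> are constant modulo 1 on cosets of
  \<open>N \<int>\<^sup>2\<close>, where \<open>N = L \<Delta> C\<close>. On a coset that meets \<open>A\<close> they are therefore 0 or 1, and at most one of them
  does not vanish there. This splits \<open>A\<close> into pieces \<open>B\<^sub>w\<close> of period \<open>L w\<close> and one piece of period
  \<open>N \<int>\<^sup>2\<close> (theorem \<open>weak_periodicity\<close>).

  \<^bold>\<open>From one period to two.\<close> The convolution of \<open>F\<close> with \<open>B\<^sub>w\<close> is \<open>N \<int>\<^sup>2\<close>-periodic, because along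
  progressions it is a bounded polynomial (lemma \<open>pieces_doubly_periodic\<close>). Dilation and averaging,
  applied to \<open>B\<^sub>w\<close>, show that the partial convolution with the points of \<open>F\<close> on one line parallel to \<open>w\<close>
  already has an explicit double period \<open>P\<close>. Such a partial convolution sees one line of \<open>B\<^sub>w\<close> at a
  time, so the lines of \<open>B\<^sub>w\<close> may be replaced by translates of representatives modulo \<open>P\<close> without
  changing the convolution (theorem \<open>column_replacement\<close>). The modified pieces make up \<open>A'\<close>.

  The period found is \<open>l\<close> times a number independent of \<open>l\<close>: a constant depending on \<open>n\<close> times a product of
  \<open>O(n\<^sup>3)\<close> determinants and coordinates of vectors \<open>w\<close>. As \<open>w\<close> has coordinates of size at most
  \<open>diam(F)\<^sup>n\<close>, each factor is \<open>O(diam(F)\<^sup>2\<^sup>n)\<close>, which gives the exponent \<open>O(n\<^sup>4)\<close>.\<close>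

section \<open>Integer vectors in the plane\<close>

(* Quantified vectors should not be split into their coordinates by simplification. *)
declare split_paired_All [simp del] split_paired_Ex [simp del]

definition smult :: "int \<Rightarrow> Z2 \<Rightarrow> Z2" (infixr \<open>\<odot>\<close> 75) where
  "k \<odot> v = (k * fst v, k * snd v)"

definition det2 :: "Z2 \<Rightarrow> Z2 \<Rightarrow> int" where
  "det2 v w = fst v * snd w - snd v * fst w"

lemma fst_smult [simp]: "fst (k \<odot> v) = k * fst v" and snd_smult [simp]: "snd (k \<odot> v) = k * snd v"
  by (simp_all add: smult_def)

lemma smult_add_left: "(a + b) \<odot> v = a \<odot> v + b \<odot> v"
  by (simp add: prod_eq_iff algebra_simps)

lemma smult_add_right: "a \<odot> (v + w) = a \<odot> v + a \<odot> w"
  by (simp add: prod_eq_iff algebra_simps)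

lemma smult_diff_right: "a \<odot> (v - w) = a \<odot> v - a \<odot> w"
  by (simp add: prod_eq_iff algebra_simps)

lemma smult_smult [simp]: "a \<odot> b \<odot> v = (a * b) \<odot> v"
  by (simp add: prod_eq_iff algebra_simps)

lemma smult_zero [simp]: "0 \<odot> v = 0" "k \<odot> (0::Z2) = 0"
  by (simp_all add: prod_eq_iff)

lemma smult_one [simp]: "1 \<odot> v = v"
  by (simp add: prod_eq_iff)

lemma smult_minus: "(- k) \<odot> v = - (k \<odot> v)"
  by (simp add: prod_eq_iff)

lemma det2_smult [simp]: "det2 (k \<odot> v) w = k * det2 v w" "det2 v (k \<odot> w) = k * det2 v w"
  by (simp_all add: det2_def algebra_simps)

lemma det2_add_right: "det2 v (w + w') = det2 v w + det2 v w'"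
  by (simp add: det2_def algebra_simps)

lemma det2_diff_right: "det2 v (w - w') = det2 v w - det2 v w'"
  by (simp add: det2_def algebra_simps)

lemma det2_self [simp]: "det2 v v = 0"
  by (simp add: det2_def)

text \<open>Cramer's rule: two non-parallel vectors span a lattice which contains every multiple of
  their determinant.\<close>

lemma cramer: "det2 v w \<odot> x = det2 x w \<odot> v + det2 v x \<odot> w"
  by (simp add: prod_eq_iff det2_def algebra_simps)

definition has_period :: "Z2 \<Rightarrow> (Z2 \<Rightarrow> 'a) \<Rightarrow> bool" where
  "has_period h g \<longleftrightarrow> (\<forall>x. g (x + h) = g x)"

lemma perD: "has_period h g \<Longrightarrow> g (x + h) = g x"
  by (simp add: has_period_def)

lemma per_add: assumes "has_period h g" "has_period h' g" shows "has_period (h + h') g"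
  using assms by (metis has_period_def add.assoc)

lemma per_uminus: assumes "has_period h g" shows "has_period (- h) g"
  unfolding has_period_def
proof
  fix x
  show "g (x + - h) = g x" using perD[OF assms, of "x - h"] by simp
qed

lemma per_smult_nat: assumes "has_period h g" shows "has_period (int n \<odot> h) g"
proof (induction n)
  case 0 show ?case by (simp add: has_period_def)
next
  case (Suc n)
  have "int (Suc n) \<odot> h = int n \<odot> h + h" by (simp add: prod_eq_iff algebra_simps)
  then show ?case using per_add[OF Suc assms] by simp
qed

lemma per_smult: assumes "has_period h g" shows "has_period (k \<odot> h) g"
proof (cases "k \<ge> 0")
  case True
  then show ?thesis using per_smult_nat[OF assms, of "nat k"] by simp
next
  case False
  then have "k \<odot> h = - (int (nat (- k)) \<odot> h)" by (simp add: prod_eq_iff)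
  then show ?thesis using per_uminus[OF per_smult_nat[OF assms, of "nat (- k)"]] by simp
qed

lemma per_minus_arg: assumes "has_period h g" shows "g (x - h) = g x"
  using per_uminus[OF assms] by (simp add: has_period_def)

section \<open>Dilation of tilings\<close>

text \<open>Finitely supported functions \<open>\<int>\<^sup>2 \<rightarrow> \<int>\<close> are Laurent polynomials in two variables; the monomial with
  exponent \<open>k\<close> acts as translation by \<open>k\<close>. Identities in this commutative ring thus become identities
  between sums of translates.\<close>

definition act :: "(Z2 \<Rightarrow>\<^sub>0 int) \<Rightarrow> (Z2 \<Rightarrow> int) \<Rightarrow> Z2 \<Rightarrow> int" where
  "act u g x = (\<Sum>k\<in>Poly_Mapping.keys u. Poly_Mapping.lookup u k * g (x - k))"

lemma act_superset:
  assumes "finite S" "Poly_Mapping.keys u \<subseteq> S"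
  shows "act u g x = (\<Sum>k\<in>S. Poly_Mapping.lookup u k * g (x - k))"
  unfolding act_def by (rule sum.mono_neutral_left) (use assms in \<open>auto simp: in_keys_iff\<close>)

lemma act_add: "act (u + v) g x = act u g x + act v g x"
proof -
  let ?S = "Poly_Mapping.keys u \<union> Poly_Mapping.keys v"
  have "finite ?S" "Poly_Mapping.keys (u + v) \<subseteq> ?S" by (auto simp: keys_add)
  then show ?thesis
    by (simp add: act_superset[of ?S] lookup_add algebra_simps sum.distrib)
qed

lemma act_zero [simp]: "act 0 g x = 0"
  by (simp add: act_def)

lemma act_sum: "act (\<Sum>i\<in>I. u i) g x = (\<Sum>i\<in>I. act (u i) g x)"
  by (induction I rule: infinite_finite_induct) (simp_all add: act_add)

lemma act_single [simp]: "act (Poly_Mapping.single k c) g x = c * g (x - k)"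
  by (simp add: act_def)

lemma sum_singles: "u = (\<Sum>k\<in>Poly_Mapping.keys u. Poly_Mapping.single k (Poly_Mapping.lookup u k))"
  by (rule poly_mapping_eqI)
    (simp add: lookup_sum lookup_single when_def sum.delta' in_keys_iff)

lemma act_mult: "act (u * v) g x = act u (act v g) x"
proof -
  have "u * v = (\<Sum>k\<in>Poly_Mapping.keys u. \<Sum>l\<in>Poly_Mapping.keys v.
      Poly_Mapping.single (k + l) (Poly_Mapping.lookup u k * Poly_Mapping.lookup v l))"
    by (subst (1) sum_singles[of u], subst (1) sum_singles[of v]) (simp add: sum_product mult_single)
  then show ?thesis
    by (simp add: act_sum act_def[of u] act_def[of v] sum_distrib_left mult.assoc algebra_simps)
qed

lemma act_of_nat: "act (of_nat p) g x = int p * g x"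
  by (metis act_single diff_zero single_of_nat)

lemma frobenius_add:
  fixes x y :: "'a::comm_ring_1"
  assumes "prime p"
  shows "\<exists>c. (x + y) ^ p = x ^ p + y ^ p + of_nat p * c"
proof -
  have p: "p > 0" using assms prime_gt_0_nat by blast
  have "(x + y) ^ p = (\<Sum>k\<le>p. of_nat (p choose k) * x ^ k * y ^ (p - k))"
    by (rule binomial_ring)
  also have "{..p} = insert 0 (insert p {1..<p})" using p by auto
  also have "(\<Sum>k\<in>insert 0 (insert p {1..<p}). of_nat (p choose k) * x ^ k * y ^ (p - k))
      = x ^ p + y ^ p + (\<Sum>k\<in>{1..<p}. of_nat (p choose k) * x ^ k * y ^ (p - k))"
    using p by (simp add: algebra_simps)
  also have "(\<Sum>k\<in>{1..<p}. of_nat (p choose k) * x ^ k * y ^ (p - k))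
      = (\<Sum>k\<in>{1..<p}. of_nat p * (of_nat ((p choose k) div p) * x ^ k * y ^ (p - k)))"
  proof (rule sum.cong[OF refl])
    fix k assume k: "k \<in> {1..<p}"
    have "p dvd p choose k" by (rule dvd_choose_prime) (use k assms in auto)
    then have "p choose k = p * ((p choose k) div p)" by simp
    then have "(of_nat (p choose k) :: 'a) = of_nat p * of_nat ((p choose k) div p)"
      by (metis of_nat_mult)
    then show "of_nat (p choose k) * x ^ k * y ^ (p - k)
        = of_nat p * (of_nat ((p choose k) div p) * x ^ k * y ^ (p - k))"
      by (simp add: mult.assoc)
  qed
  finally show ?thesis by (simp only: sum_distrib_left[symmetric]) blast
qed

text \<open>The ring of Laurent polynomials over \<open>\<int>\<close> has characteristic 0, so the Frobenius identity modulo \<open>p\<close>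
  carries an explicit multiple of \<open>p\<close>.\<close>

lemma frobenius_sum:
  fixes u :: "'i \<Rightarrow> 'a::comm_ring_1"
  assumes "prime p" "finite I"
  shows "\<exists>c. (\<Sum>i\<in>I. u i) ^ p = (\<Sum>i\<in>I. u i ^ p) + of_nat p * c"
  using assms(2)
proof induction
  case empty
  show ?case using prime_gt_0_nat[OF assms(1)] by (intro exI[of _ 0]) (simp add: zero_power)
next
  case (insert i I)
  then obtain c where c: "(\<Sum>i\<in>I. u i) ^ p = (\<Sum>i\<in>I. u i ^ p) + of_nat p * c" by blast
  obtain d where "(u i + (\<Sum>i\<in>I. u i)) ^ p = u i ^ p + (\<Sum>i\<in>I. u i) ^ p + of_nat p * d"
    using frobenius_add[OF assms(1)] by blast
  then show ?case using insert c by (intro exI[of _ "c + d"]) (simp add: algebra_simps)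
qed

lemma single_power: "Poly_Mapping.single k (1::int) ^ n = Poly_Mapping.single (int n \<odot> k) 1"
proof (induction n)
  case (Suc n)
  have "k + int n \<odot> k = int (Suc n) \<odot> k" by (simp add: prod_eq_iff algebra_simps)
  then show ?case using Suc by (simp add: mult_single)
qed simp

text \<open>If \<open>u\<close> is the sum of the monomials \<open>v i\<close> and \<open>u\<close> annihilates \<open>g\<close>, then so does \<open>u ^ p\<close>, which modulo \<open>p\<close>
  is the sum of the monomials \<open>p \<odot> v i\<close>.\<close>

lemma annihilator_dilate_prime:
  fixes g :: "Z2 \<Rightarrow> int"
  assumes "prime p" "finite I" and zero: "\<And>x. (\<Sum>i\<in>I. g (x - v i)) = 0"
  shows "int p dvd (\<Sum>i\<in>I. g (x - int p \<odot> v i))"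
proof -
  define u where "u = (\<Sum>i\<in>I. Poly_Mapping.single (v i) (1::int))"
  obtain c where c: "u ^ p = (\<Sum>i\<in>I. Poly_Mapping.single (v i) 1 ^ p) + of_nat p * c"
    using frobenius_sum[OF assms(1,2)] unfolding u_def by blast
  have u0: "act u g = (\<lambda>_. 0)" by (rule ext) (simp add: u_def act_sum zero)
  have "u ^ p = u ^ (p - 1) * u"
    using prime_gt_0_nat[OF assms(1)] by (metis power_minus_mult)
  then have "act (u ^ p) g x = 0" by (simp add: act_mult u0) (simp add: act_def)
  then have "(\<Sum>i\<in>I. g (x - int p \<odot> v i)) + int p * act c g x = 0"
    by (simp add: c act_add act_sum single_power act_mult act_of_nat)
  then have "(\<Sum>i\<in>I. g (x - int p \<odot> v i)) = int p * (- act c g x)" by simp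
  then show ?thesis by (rule dvdI)
qed

text \<open>For a prime \<open>p > card I\<close> a multiple of \<open>p\<close> that is a sum of \<open>card I\<close> numbers of absolute value at most 1
  must vanish. The prime factors of \<open>r\<close> are treated one after the other.\<close>

lemma annihilator_dilate:
  fixes g :: "Z2 \<Rightarrow> int"
  assumes fin: "finite I" and bound: "\<And>x. \<bar>g x\<bar> \<le> 1"
    and zero: "\<And>x. (\<Sum>i\<in>I. g (x - v i)) = 0"
    and "r > 0" and large: "\<And>p. prime p \<Longrightarrow> p dvd r \<Longrightarrow> card I < p"
  shows "(\<Sum>i\<in>I. g (x - int r \<odot> v i)) = 0"
  using \<open>r > 0\<close> large
proof (induction r arbitrary: x rule: prime_divisors_induct)
  case zero then show ?case by simp
next
  case (unit r)
  then show ?case using zero by simp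
next
  case (factor p r)
  have IH: "(\<Sum>i\<in>I. g (x - int r \<odot> v i)) = 0" for x
    using factor.IH factor.prems by auto
  have "int p dvd (\<Sum>i\<in>I. g (x - int p \<odot> (int r \<odot> v i)))"
    by (rule annihilator_dilate_prime[OF factor.hyps(1) fin IH])
  moreover have "\<bar>\<Sum>i\<in>I. g (x - int p \<odot> (int r \<odot> v i))\<bar> < int p"
  proof -
    have "\<bar>\<Sum>i\<in>I. g (x - int p \<odot> (int r \<odot> v i))\<bar> \<le> (\<Sum>i\<in>I. 1)"
      by (rule order_trans[OF sum_abs sum_mono]) (rule bound)
    also have "\<dots> < int p" using factor.prems(2)[of p] factor.hyps by simp
    finally show ?thesis .
  qed
  ultimately have "(\<Sum>i\<in>I. g (x - int p \<odot> (int r \<odot> v i))) = 0"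
    by (metis abs_of_nat dvd_imp_le_int not_le)
  then show ?case by simp
qed

text \<open>Averaging over many multiples of one \<open>h j\<close> makes the coboundary with step \<open>h j\<close> negligible and leaves
  the form of the other ones unchanged; so all of them can be removed in turn.\<close>

lemma constant_coboundary:
  fixes a :: "'i \<Rightarrow> Z2 \<Rightarrow> real"
  assumes "finite I" and "\<And>i x. i \<in> I \<Longrightarrow> \<bar>a i x\<bar> \<le> 1"
    and "\<And>x. \<bar>d - (\<Sum>i\<in>I. a i (x + h i) - a i x)\<bar> \<le> \<epsilon>"
  shows "\<bar>d\<bar> \<le> \<epsilon>"
  using assms
proof (induction I arbitrary: a \<epsilon> rule: finite_induct)
  case empty
  then show ?case by simp
next
  case (insert j I)
  have step: "\<bar>d\<bar> \<le> \<epsilon> + 2 / real K" if K: "K > 0" for K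
  proof -
    define avg where "avg f x = (\<Sum>k<K. f (x + int k \<odot> h j)) / real K" for f :: "Z2 \<Rightarrow> real" and x
    have "\<bar>d - (\<Sum>i\<in>I. avg (a i) (x + h i) - avg (a i) x)\<bar> \<le> \<epsilon> + 2 / real K" for x
    proof -
      define y where "y k = x + int k \<odot> h j" for k
      have ySuc: "y (Suc k) = y k + h j" for k by (simp add: y_def prod_eq_iff algebra_simps)
      have tele: "(\<Sum>k<K. a j (y k + h j) - a j (y k)) = a j (y K) - a j (y 0)"
        using sum_lessThan_telescope[of "\<lambda>k. a j (y k)" K] by (simp add: ySuc)
      have "(\<Sum>k<K. d - (\<Sum>i\<in>insert j I. a i (y k + h i) - a i (y k)))
          = K * d - (a j (y K) - a j (y 0)) - (\<Sum>k<K. \<Sum>i\<in>I. a i (y k + h i) - a i (y k))"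
        using insert.hyps by (simp add: sum_subtractf sum.distrib tele[symmetric] algebra_simps)
      moreover have "\<bar>\<Sum>k<K. d - (\<Sum>i\<in>insert j I. a i (y k + h i) - a i (y k))\<bar> \<le> (\<Sum>k<K. \<epsilon>)"
        by (rule order_trans[OF sum_abs sum_mono]) (rule insert.prems(2))
      moreover have "\<bar>a j (y K)\<bar> \<le> 1" "\<bar>a j (y 0)\<bar> \<le> 1" using insert.prems(1) by auto
      ultimately have "\<bar>K * d - (\<Sum>k<K. \<Sum>i\<in>I. a i (y k + h i) - a i (y k))\<bar> \<le> K * \<epsilon> + 2"
        by simp
      moreover have "(\<Sum>k<K. \<Sum>i\<in>I. a i (y k + h i) - a i (y k))
          = K * (\<Sum>i\<in>I. avg (a i) (x + h i) - avg (a i) x)"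
      proof -
        have "K * (avg (a i) (x + h i) - avg (a i) x) = (\<Sum>k<K. a i (y k + h i) - a i (y k))" for i
          using K by (simp add: avg_def y_def sum_subtractf right_diff_distrib add.assoc add.commute[of "h i"])
        then show ?thesis by (subst sum.swap) (simp add: sum_distrib_left)
      qed
      ultimately have "\<bar>real K * (d - (\<Sum>i\<in>I. avg (a i) (x + h i) - avg (a i) x))\<bar> \<le> K * \<epsilon> + 2"
        by (simp add: right_diff_distrib)
      then have "real K * \<bar>d - (\<Sum>i\<in>I. avg (a i) (x + h i) - avg (a i) x)\<bar> \<le> real K * (\<epsilon> + 2 / real K)"
        using K by (simp add: abs_mult distrib_left)
      then show ?thesis using K by (simp only: mult_le_cancel_left_pos of_nat_0_less_iff)
    qed
    moreover have "\<bar>avg (a i) x\<bar> \<le> 1" if "i \<in> I" for i x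
    proof -
      have "\<bar>\<Sum>k<K. a i (x + int k \<odot> h j)\<bar> \<le> (\<Sum>k<K. 1)"
        by (rule order_trans[OF sum_abs sum_mono]) (rule insert.prems(1), simp add: that)
      then show ?thesis using K by (simp add: avg_def)
    qed
    ultimately show ?thesis using insert.IH[of "\<lambda>i. avg (a i)" "\<epsilon> + 2 / real K"] by blast
  qed
  have "(\<lambda>K. \<epsilon> + 2 / real K) \<longlonglongrightarrow> \<epsilon> + 0"
    by (intro tendsto_add tendsto_const tendsto_divide_0[OF tendsto_const] filterlim_at_top_imp_at_infinity
          filterlim_real_sequentially)
  moreover have "eventually (\<lambda>K. \<bar>d\<bar> \<le> \<epsilon> + 2 / real K) sequentially"
    using eventually_gt_at_top[of 0] by eventually_elim (rule step)
  ultimately have "\<bar>d\<bar> \<le> \<epsilon> + 0" by (rule tendsto_lowerbound) (rule sequentially_bot)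
  then show ?case by (simp only: add_0_right)
qed

text \<open>The difference of \<open>A\<close> and a translate of \<open>A\<close> by a vector of \<open>l \<int>\<^sup>2\<close> is annihilated by the translations
  \<open>v i\<close>, hence by the dilated ones: the dilated sum \<open>E\<close> is \<open>l \<int>\<^sup>2\<close>-periodic. The dilation moves \<open>v i\<close> by a
  vector of \<open>l \<int>\<^sup>2\<close>, so on each coset of \<open>l \<int>\<^sup>2\<close> the constant \<open>E - e\<close> is a sum of coboundaries and
  vanishes.\<close>

lemma dilation:
  fixes A :: "Z2 set" and e :: "Z2 \<Rightarrow> real"
  assumes fin: "finite I"
    and tile: "\<And>x. (\<Sum>i\<in>I. indicator A (x - v i)) = e x"
    and has_period: "\<And>z. has_period (l \<odot> z) e"
    and Y: "l dvd Y" "fact (card I) dvd Y" "Y > 0"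
  shows "(\<Sum>i\<in>I. indicator A (x - (1 + int s * Y) \<odot> v i)) = e x"
proof -
  define r where "r = nat (1 + int s * Y)"
  have r: "int r = 1 + int s * Y" using Y by (simp add: r_def)
  have rpos: "r > 0" using r Y by (simp add: r_def add_pos_nonneg)
  have large: "card I < p" if "prime p" "p dvd r" for p
  proof (rule ccontr)
    assume "\<not> card I < p"
    then have "p dvd fact (card I)" using that by (simp add: prime_dvd_fact_iff)
    then have "int p dvd fact (card I)" by (metis int_dvd_int_iff of_nat_fact)
    then have "int p dvd int s * Y" using Y(2) dvd_trans dvd_mult by blast
    moreover have "int p dvd 1 + int s * Y" using that(2) r by (metis int_dvd_int_iff)
    ultimately have "int p dvd 1" using dvd_add_left_iff by blast
    then show False using that(1) by simp
  qed
  define E where "E x = (\<Sum>i\<in>I. indicator A (x - int r \<odot> v i) :: real)" for x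
  \<comment> \<open>The translate by \<open>l \<odot> z\<close> minus the original is a difference of indicators, hence bounded by 1.\<close>
  have E_per: "E (x + l \<odot> z) = E x" for x z
  proof -
    define g :: "Z2 \<Rightarrow> int" where "g y = of_bool (y + l \<odot> z \<in> A) - of_bool (y \<in> A)" for y
    have g_real: "real_of_int (g y) = indicator A (y + l \<odot> z) - indicator A y" for y
      by (simp add: g_def indicator_def)
    have shift: "x - w + l \<odot> z = x + l \<odot> z - w" for x w :: Z2 by simp
    have "(\<Sum>i\<in>I. g (x - v i)) = 0" for x
    proof -
      have "real_of_int (\<Sum>i\<in>I. g (x - v i)) = e (x + l \<odot> z) - e x"
        by (simp add: g_real sum_subtractf shift tile)
      then have "real_of_int (\<Sum>i\<in>I. g (x - v i)) = 0" using perD[OF has_period] by simp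
      then show ?thesis by (simp only: of_int_eq_0_iff)
    qed
    then have "(\<Sum>i\<in>I. g (x - int r \<odot> v i)) = 0"
      by (intro annihilator_dilate[OF fin _ _ rpos large]) (auto simp: g_def)
    then have "real_of_int (\<Sum>i\<in>I. g (x - int r \<odot> v i)) = 0" by simp
    then show ?thesis by (simp add: E_def g_real sum_subtractf shift)
  qed
  have "\<bar>E x - e x\<bar> \<le> 0"
  proof (rule constant_coboundary[OF fin])
    let ?m = "int s * (Y div l)"
    define a where "a i z = (indicator A (x - v i + l \<odot> z) :: real)" for i z
    define h where "h i = - ?m \<odot> v i" for i
    show "\<bar>a i z\<bar> \<le> 1" for i z by (simp add: a_def indicator_def)
    have lm: "l * ?m = int s * Y" using Y(1) by (metis dvd_mult_div_cancel mult.left_commute)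
    have "a i (z + h i) = indicator A (x + l \<odot> z - int r \<odot> v i)" for i z
    proof -
      have "l \<odot> h i = - (int s * Y) \<odot> v i" by (simp add: h_def lm[symmetric] mult.assoc)
      then have "x - v i + l \<odot> (z + h i) = x + l \<odot> z - int r \<odot> v i"
        by (simp add: smult_add_right smult_add_left smult_minus r)
      then show ?thesis unfolding a_def by (rule arg_cong)
    qed
    moreover have "a i z = indicator A (x + l \<odot> z - v i)" for i z
    proof -
      have "x - v i + l \<odot> z = x + l \<odot> z - v i" by simp
      then show ?thesis unfolding a_def by (rule arg_cong)
    qed
    ultimately have "(\<Sum>i\<in>I. a i (z + h i) - a i z) = E (x + l \<odot> z) - e (x + l \<odot> z)" for z
      unfolding sum_subtractf E_def tile[symmetric] by simp
    then show "\<bar>E x - e x - (\<Sum>i\<in>I. a i (z + h i) - a i z)\<bar> \<le> 0" for z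
      by (simp add: E_per perD[OF has_period])
  qed
  then show ?thesis by (simp add: E_def r)
qed

text \<open>\<open>\<phi> i\<close> is the limit, along a common subsequence, of the averages over \<open>s\<close> of the translates of \<open>A\<close> by
  \<open>(1 + s Y) v\<^sub>i\<close>. Translating by \<open>Y v\<^sub>i\<close> shifts the index \<open>s\<close> by one, which is invisible to the limit.\<close>

lemma averaging:
  fixes A :: "Z2 set" and v :: "'i \<Rightarrow> Z2"
  assumes fin: "finite I"
    and tile: "\<And>s x. (\<Sum>i\<in>I. indicator A (x - (1 + int s * Y) \<odot> v i)) = (e x :: real)"
  obtains \<phi> :: "'i \<Rightarrow> Z2 \<Rightarrow> real" where
    "\<And>i x. i \<in> I \<Longrightarrow> 0 \<le> \<phi> i x"
    "\<And>x. (\<Sum>i\<in>I. \<phi> i x) = e x"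
    "\<And>i. i \<in> I \<Longrightarrow> has_period (Y \<odot> v i) (\<phi> i)"
    "\<And>i h. i \<in> I \<Longrightarrow> has_period h (indicator A :: Z2 \<Rightarrow> real) \<Longrightarrow> has_period h (\<phi> i)"
    "\<And>i x. i \<in> I \<Longrightarrow> has_period (Y \<odot> v i) (indicator A :: Z2 \<Rightarrow> real) \<Longrightarrow> \<phi> i x = indicator A (x - v i)"
proof -
  define a where "a i s x = (indicator A (x - (1 + int s * Y) \<odot> v i) :: real)" for i s x
  define c where "c N j = (\<Sum>s<Suc N. a (fst j) s (snd j)) / real (Suc N)" for N and j :: "'i \<times> Z2"
  have a01: "0 \<le> a i s x" "a i s x \<le> 1" for i s x by (auto simp: a_def indicator_def)
  have c0: "0 \<le> c N j" for N j unfolding c_def by (intro divide_nonneg_nonneg sum_nonneg a01) simp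
  have c1: "c N j \<le> 1" for N j
  proof -
    have "(\<Sum>s<Suc N. a (fst j) s (snd j)) \<le> (\<Sum>s<Suc N. 1)" by (rule sum_mono) (rule a01)
    then show ?thesis by (simp add: c_def)
  qed
  have "countable (I \<times> (UNIV :: Z2 set))" using fin by (intro countable_SIGMA) (auto intro: countable_finite)
  then obtain k where k: "strict_mono (k :: nat \<Rightarrow> nat)"
    and conv: "\<And>j. j \<in> I \<times> UNIV \<Longrightarrow> \<exists>l. (\<lambda>n. c (k n) j) \<longlonglongrightarrow> l"
    by (rule function_convergent_subsequence[of _ c 1]) (use c0 c1 in auto)
  define \<phi> where "\<phi> i x = lim (\<lambda>n. c (k n) (i, x))" for i x
  have lim: "(\<lambda>n. c (k n) (i, x)) \<longlonglongrightarrow> \<phi> i x" if "i \<in> I" for i x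
    unfolding \<phi>_def using conv[of "(i, x)"] that by (metis UNIV_I limI SigmaI)
  have uniq: "\<phi> i x = l" if "i \<in> I" "(\<lambda>n. c (k n) (i, x)) \<longlonglongrightarrow> l" for i x l
    using LIMSEQ_unique[OF lim[OF that(1)] that(2)] .
  have kinf: "filterlim (\<lambda>n. real (Suc (k n))) at_infinity sequentially"
    by (intro filterlim_at_top_imp_at_infinity filterlim_compose[OF filterlim_real_sequentially]
          filterlim_compose[OF filterlim_Suc] filterlim_subseq k)
  show ?thesis
  proof
    show "0 \<le> \<phi> i x" if "i \<in> I" for i x
      by (rule LIMSEQ_le_const[OF lim[OF that]]) (use c0 in auto)
    show "(\<Sum>i\<in>I. \<phi> i x) = e x" for x
    proof -
      have "(\<Sum>i\<in>I. c N (i, x)) = e x" for N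
      proof -
        have "(\<Sum>i\<in>I. c N (i, x)) = (\<Sum>s<Suc N. \<Sum>i\<in>I. a i s x) / real (Suc N)"
          unfolding c_def by (subst sum.swap) (simp only: sum_divide_distrib fst_conv snd_conv)
        also have "\<dots> = (\<Sum>s<Suc N. e x) / real (Suc N)" by (simp only: a_def tile)
        also have "\<dots> = e x" by simp
        finally show ?thesis .
      qed
      then have "(\<lambda>n. \<Sum>i\<in>I. c (k n) (i, x)) \<longlonglongrightarrow> e x" by simp
      moreover have "(\<lambda>n. \<Sum>i\<in>I. c (k n) (i, x)) \<longlonglongrightarrow> (\<Sum>i\<in>I. \<phi> i x)"
        by (rule tendsto_sum) (rule lim)
      ultimately show ?thesis using LIMSEQ_unique by blast
    qed
    show "has_period (Y \<odot> v i) (\<phi> i)" if i: "i \<in> I" for i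
      unfolding has_period_def
    proof
      fix x
      define b where "b n = c (k n) (i, x + Y \<odot> v i) - c (k n) (i, x)" for n
      have "\<bar>b n\<bar> \<le> 1 / real (Suc (k n))" for n
      proof -
        have shift: "a i (Suc s) (x + Y \<odot> v i) = a i s x" for s
        proof -
          have "x + Y \<odot> v i - (1 + int (Suc s) * Y) \<odot> v i = x - (1 + int s * Y) \<odot> v i"
            by (simp add: prod_eq_iff algebra_simps)
          then show ?thesis unfolding a_def by (rule arg_cong)
        qed
        have "(\<Sum>s<Suc m. a i s (x + Y \<odot> v i)) - (\<Sum>s<Suc m. a i s x) = a i 0 (x + Y \<odot> v i) - a i m x" for m
          by (subst sum.lessThan_Suc_shift) (simp add: shift)
        then have "b n = (a i 0 (x + Y \<odot> v i) - a i (k n) x) / real (Suc (k n))"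
          unfolding b_def c_def fst_conv snd_conv by (simp only: diff_divide_distrib[symmetric])
        moreover have "\<bar>a i 0 (x + Y \<odot> v i) - a i (k n) x\<bar> \<le> 1"
          using a01[of i 0 "x + Y \<odot> v i"] a01[of i "k n" x] by linarith
        ultimately show ?thesis by (simp add: divide_right_mono)
      qed
      moreover have "(\<lambda>n. 1 / real (Suc (k n))) \<longlonglongrightarrow> 0"
        by (rule tendsto_divide_0[OF tendsto_const kinf])
      ultimately have "b \<longlonglongrightarrow> 0"
        by (intro Lim_null_comparison[of b]) (simp_all add: eventually_sequentially)
      then have "(\<lambda>n. b n + c (k n) (i, x)) \<longlonglongrightarrow> 0 + \<phi> i x" by (intro tendsto_add lim i)
      then show "\<phi> i (x + Y \<odot> v i) = \<phi> i x" by (intro uniq i) (simp add: b_def)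
    qed
    show "has_period h (\<phi> i)" if i: "i \<in> I" and h: "has_period h (indicator A :: Z2 \<Rightarrow> real)" for i h
      unfolding has_period_def
    proof
      fix x
      have "a i s (x + h) = a i s x" for s
      proof -
        have "x + h - (1 + int s * Y) \<odot> v i = x - (1 + int s * Y) \<odot> v i + h" by simp
        then show ?thesis unfolding a_def using perD[OF h] by metis
      qed
      then have "c N (i, x + h) = c N (i, x)" for N by (simp add: c_def)
      then show "\<phi> i (x + h) = \<phi> i x" by (simp add: \<phi>_def)
    qed
    show "\<phi> i x = indicator A (x - v i)"
      if i: "i \<in> I" and h: "has_period (Y \<odot> v i) (indicator A :: Z2 \<Rightarrow> real)" for i x
    proof -
      have "a i s x = indicator A (x - v i)" for s
      proof -
        have "x - (1 + int s * Y) \<odot> v i = x - v i - int s \<odot> (Y \<odot> v i)"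
          by (simp add: prod_eq_iff algebra_simps)
        then show ?thesis unfolding a_def using per_minus_arg[OF per_smult[OF h]] by metis
      qed
      then have "c N (i, x) = indicator A (x - v i)" for N by (simp add: c_def)
      then show ?thesis by (intro uniq i) simp
    qed
  qed
qed

section \<open>Polynomials modulo a group of constants\<close>

text \<open>\<open>P\<close> is a polynomial of degree less than \<open>k\<close> modulo \<open>S\<close> if its \<open>k\<close>-th difference takes values in \<open>S\<close>.
  The cases of interest are \<open>S = \<int>\<close> and \<open>S = {0}\<close>.\<close>

fun poly_mod :: "real set \<Rightarrow> nat \<Rightarrow> (int \<Rightarrow> real) \<Rightarrow> bool" where
  "poly_mod S 0 P \<longleftrightarrow> (\<forall>t. P t \<in> S)"
| "poly_mod S (Suc k) P \<longleftrightarrow> poly_mod S k (\<lambda>t. P (t + 1) - P t)"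

lemma poly_mod_shift: "poly_mod S k P \<Longrightarrow> poly_mod S k (\<lambda>t. P (t + a))"
proof (induction k arbitrary: P)
  case (Suc k)
  from Suc.IH[of "\<lambda>t. P (t + 1) - P t"] Suc.prems show ?case by (simp add: ac_simps)
qed simp

lemma poly_mod_Ints_add:
  "poly_mod \<int> k P \<Longrightarrow> poly_mod \<int> k Q \<Longrightarrow> poly_mod \<int> k (\<lambda>t. P t + Q t)"
proof (induction k arbitrary: P Q)
  case (Suc k)
  from Suc.IH[of "\<lambda>t. P (t + 1) - P t" "\<lambda>t. Q (t + 1) - Q t"] Suc.prems
  show ?case by (simp add: algebra_simps)
qed simp

lemma poly_mod_Ints_mult: "poly_mod \<int> k P \<Longrightarrow> poly_mod \<int> k (\<lambda>t. of_int m * P t)"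
proof (induction k arbitrary: P)
  case (Suc k)
  from Suc.IH[of "\<lambda>t. P (t + 1) - P t"] Suc.prems show ?case by (simp add: algebra_simps)
qed simp

lemma poly_mod_Ints_diff:
  assumes "poly_mod \<int> k P" "poly_mod \<int> k Q"
  shows "poly_mod \<int> k (\<lambda>t. P t - Q t)"
  using poly_mod_Ints_add[OF assms(1) poly_mod_Ints_mult[OF assms(2), of "-1"]] by simp

lemma poly_mod_Ints_Suc: "poly_mod \<int> k P \<Longrightarrow> poly_mod \<int> (Suc k) P"
  using poly_mod_Ints_diff[OF poly_mod_shift] by simp

lemma poly_mod_Ints_le: "k \<le> n \<Longrightarrow> poly_mod \<int> k P \<Longrightarrow> poly_mod \<int> n P"
  by (induction rule: dec_induct) (simp_all only: poly_mod_Ints_Suc)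

lemma poly_mod_Ints_step:
  assumes "poly_mod \<int> (Suc k) P"
  shows "poly_mod \<int> k (\<lambda>t. P (t + int b) - P t)"
proof (induction b)
  case 0
  have "poly_mod \<int> k (\<lambda>t. of_int 0 * (P (t + 1) - P t))"
    by (rule poly_mod_Ints_mult) (use assms in simp)
  then show ?case by simp
next
  case (Suc b)
  have "poly_mod \<int> k (\<lambda>t. P (t + int b + 1) - P (t + int b))"
    using poly_mod_shift[of _ k "\<lambda>t. P (t + 1) - P t" "int b"] assms by (simp add: ac_simps)
  from poly_mod_Ints_add[OF this Suc] show ?case by (simp add: ac_simps)
qed

definition period_mod1 :: "nat \<Rightarrow> (int \<Rightarrow> real) \<Rightarrow> bool" where
  "period_mod1 Q P \<longleftrightarrow> (\<forall>t. P (t + int Q) - P t \<in> \<int>)"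

lemma per1_mult: assumes "period_mod1 Q P" shows "P (t + int (j * Q)) - P t \<in> \<int>"
proof (induction j)
  case (Suc j)
  have "P (t + int (j * Q) + int Q) - P (t + int (j * Q)) \<in> \<int>" using assms by (simp add: period_mod1_def)
  from Ints_add[OF this Suc] show ?case by (simp add: algebra_simps)
qed simp

lemma per1_dvd: "period_mod1 Q P \<Longrightarrow> Q dvd Q' \<Longrightarrow> period_mod1 Q' P"
  using per1_mult by (metis dvd_def mult.commute period_mod1_def)

text \<open>The increments of \<open>P\<close> between consecutive points of a progression of step \<open>Q\<close> all agree modulo 1.\<close>

lemma progression_affine:
  assumes "period_mod1 Q (\<lambda>t. P (t + int Q) - P t)"
  shows "P (t + int (j * Q)) - P t - of_nat j * (P (t + int Q) - P t) \<in> \<int>"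
proof (induction j)
  case (Suc j)
  have "P (t + int (j * Q) + int Q) - P (t + int (j * Q)) - (P (t + int Q) - P t) \<in> \<int>"
    using per1_mult[OF assms, of t j] .
  from Ints_add[OF this Suc] show ?case by (simp add: algebra_simps)
qed simp

text \<open>By induction the first difference of \<open>P\<close> has period \<open>m ^ k\<close>. Then \<open>P\<close> changes by the same amount over
  each of \<open>m\<close> consecutive blocks of that length, and \<open>m\<close> times this amount is an integer.\<close>

lemma torsion_poly_periodic:
  assumes "poly_mod \<int> k P" and "\<And>t. of_nat m * P t \<in> \<int>"
  shows "period_mod1 (m ^ k) P"
  using assms
proof (induction k arbitrary: P)
  case 0
  then show ?case by (simp add: period_mod1_def)
next
  case (Suc k)
  let ?p = "m ^ k"
  have "period_mod1 ?p (\<lambda>t. P (t + 1) - P t)"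
    using Suc.prems by (intro Suc.IH) (auto simp: right_diff_distrib)
  then have d: "P (t + int ?p + 1) - P (t + int ?p) - (P (t + 1) - P t) \<in> \<int>" for t
    by (simp add: period_mod1_def)
  have "(P (t + int n + int ?p) - P (t + int n)) - (P (t + int ?p) - P t) \<in> \<int>" for t n
  proof (induction n)
    case (Suc n)
    from Ints_add[OF d[of "t + int n"] Suc] show ?case by (simp add: algebra_simps)
  qed simp
  then have "period_mod1 ?p (\<lambda>t. P (t + int ?p) - P t)" by (simp only: period_mod1_def) blast
  then have "P (t + int (m * ?p)) - P t - of_nat m * (P (t + int ?p) - P t) \<in> \<int>" for t
    by (rule progression_affine)
  moreover have "of_nat m * (P (t + int ?p) - P t) \<in> \<int>" for t
    using Suc.prems(2) by (simp add: right_diff_distrib)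
  ultimately have "P (t + int (m * ?p)) - P t \<in> \<int>" for t
    by (metis Ints_add diff_add_cancel)
  then show ?case by (simp add: period_mod1_def)
qed

text \<open>The values of the first difference over one period add up to an integer, and by induction they agree
  up to torsion; so each of them is torsion.\<close>

lemma periodic_poly_torsion:
  assumes "poly_mod \<int> k P" and "period_mod1 Q P"
  shows "of_nat (Q ^ k) * (P x - P y) \<in> \<int>"
  using assms
proof (induction k arbitrary: P x y)
  case 0
  then show ?case by simp
next
  case (Suc k)
  define D where "D t = P (t + 1) - P t" for t
  have perD: "period_mod1 Q D"
    unfolding period_mod1_def D_def
  proof
    fix t
    have "P (t + 1 + int Q) - P (t + 1) \<in> \<int>" "P (t + int Q) - P t \<in> \<int>"
      using Suc.prems(2) by (simp_all add: period_mod1_def)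
    from Ints_diff[OF this] show "P (t + int Q + 1) - P (t + int Q) - (P (t + 1) - P t) \<in> \<int>"
      by (simp add: algebra_simps)
  qed
  have IH: "of_nat (Q ^ k) * (D x - D y) \<in> \<int>" for x y
    by (rule Suc.IH) (use Suc.prems perD in \<open>simp_all add: D_def[abs_def]\<close>)
  have step: "of_nat (Q ^ Suc k) * D y \<in> \<int>" for y
  proof -
    have "(\<Sum>i<Q. of_nat (Q ^ k) * (D (y + int i) - D y)) \<in> \<int>" by (intro Ints_sum IH)
    moreover have "(\<Sum>i<Q. D (y + int i)) = P (y + int Q) - P y"
      using sum_lessThan_telescope[of "\<lambda>i. P (y + int i)" Q] by (simp add: D_def ac_simps)
    then have eq: "(\<Sum>i<Q. D (y + int i) - D y) = P (y + int Q) - P y - Q * D y"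
      by (simp add: sum_subtractf)
    have "(\<Sum>i<Q. of_nat (Q ^ k) * (D (y + int i) - D y))
        = of_nat (Q ^ k) * (P (y + int Q) - P y) - of_nat (Q ^ Suc k) * D y"
      unfolding sum_distrib_left[symmetric] eq by (simp add: algebra_simps)
    moreover have "of_nat (Q ^ k) * (P (y + int Q) - P y) \<in> \<int>"
      using Suc.prems(2) by (intro Ints_mult) (simp_all add: period_mod1_def)
    ultimately show ?thesis by (metis Ints_diff diff_diff_eq2 add_diff_cancel_left')
  qed
  have nat: "of_nat (Q ^ Suc k) * (P (y + int n) - P y) \<in> \<int>" for y n
  proof (induction n)
    case (Suc n)
    from Ints_add[OF step[of "y + int n"] Suc] show ?case by (simp add: D_def algebra_simps)
  qed simp
  show ?case
  proof (cases "x \<ge> y")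
    case True
    then show ?thesis using nat[of y "nat (x - y)"] by simp
  next
    case False
    then have "of_nat (Q ^ Suc k) * (P y - P x) \<in> \<int>" using nat[of x "nat (y - x)"] by simp
    from Ints_minus[OF this] show ?thesis by (simp add: algebra_simps)
  qed
qed

section \<open>Weyl sums\<close>

lemma sum_shift_le:
  fixes w :: "nat \<Rightarrow> complex"
  assumes "\<And>t. norm (w t) \<le> 1"
  shows "norm ((\<Sum>t<N. w (t + h)) - (\<Sum>t<N. w t)) \<le> 2 * real h"
proof (induction h)
  case (Suc h)
  have "(\<Sum>t<N. w (t + Suc h)) - (\<Sum>t<N. w (t + h)) = w (N + h) - w h"
    using sum_lessThan_telescope[of "\<lambda>t. w (t + h)" N] by (simp add: sum_subtractf)
  then have "norm ((\<Sum>t<N. w (t + Suc h)) - (\<Sum>t<N. w (t + h))) \<le> 2"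
    using norm_triangle_ineq4[of "w (N + h)" "w h"] assms[of "N + h"] assms[of h] by simp
  moreover have "(\<Sum>t<N. w (t + Suc h)) - (\<Sum>t<N. w t)
      = ((\<Sum>t<N. w (t + Suc h)) - (\<Sum>t<N. w (t + h))) + ((\<Sum>t<N. w (t + h)) - (\<Sum>t<N. w t))" by simp
  ultimately show ?case using Suc norm_triangle_ineq by (smt (verit) of_nat_Suc)
qed simp

text \<open>Compare \<open>\<Sum>t<N. u t\<close> with the average of its \<open>H\<close> shifts, apply the Cauchy-Schwarz inequality, and expand
  the square into correlations of \<open>u\<close> with its shifts.\<close>

lemma van_der_corput_inequality:
  fixes u :: "nat \<Rightarrow> complex" and \<eta> :: real
  assumes u: "\<And>t. norm (u t) = 1"
    and corr: "\<And>b. b \<in> {1..<H} \<Longrightarrow> norm (\<Sum>t<N. u (t + b) * cnj (u t)) \<le> \<eta> * N"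
    and "\<eta> \<ge> 0"
  shows "real H * norm (\<Sum>t<N. u t)
    \<le> sqrt (real N * (real H * real N + real H^2 * (\<eta> * real N + 2 * real H))) + 2 * real H^2"
proof -
  define s where "s t = (\<Sum>h<H. u (t + h))" for t
  define c where "c h h' = (\<Sum>t<N. u (t + h) * cnj (u (t + h')))" for h h'
  have c_lt: "norm (c h h') \<le> \<eta> * N + 2 * H" if "h' < h" "h < H" for h h'
  proof -
    define w where "w t = u (t + (h - h')) * cnj (u t)" for t
    have "c h h' = (\<Sum>t<N. w (t + h'))" using that by (simp add: c_def w_def)
    moreover have "norm ((\<Sum>t<N. w (t + h')) - (\<Sum>t<N. w t)) \<le> 2 * real h'"
      by (rule sum_shift_le) (simp add: w_def norm_mult u)
    moreover have "norm (\<Sum>t<N. w t) \<le> \<eta> * N" unfolding w_def by (rule corr) (use that in auto)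
    moreover have "norm (\<Sum>t<N. w (t + h')) \<le> norm (\<Sum>t<N. w t) + norm ((\<Sum>t<N. w (t + h')) - (\<Sum>t<N. w t))"
      by (rule norm_triangle_sub)
    ultimately show ?thesis using that by simp
  qed
  have c_sym: "c h' h = cnj (c h h')" for h h' by (simp add: c_def mult.commute)
  have c_ne: "norm (c h h') \<le> \<eta> * N + 2 * H" if "h \<noteq> h'" "h < H" "h' < H" for h h'
    using c_lt[of h h'] c_lt[of h' h] c_sym[of h h'] that by (metis complex_mod_cnj linorder_neqE_nat)
  have c_eq: "norm (c h h) \<le> N" for h
    unfolding c_def by (rule order_trans[OF norm_sum]) (simp add: norm_mult u)
  have "complex_of_real (\<Sum>t<N. norm (s t) ^ 2) = (\<Sum>h<H. \<Sum>h'<H. c h h')"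
  proof -
    have "complex_of_real (\<Sum>t<N. norm (s t) ^ 2) = (\<Sum>t<N. \<Sum>h<H. \<Sum>h'<H. u (t + h) * cnj (u (t + h')))"
      by (simp only: of_real_sum complex_norm_square s_def cnj_sum sum_product)
    also have "\<dots> = (\<Sum>h<H. \<Sum>t<N. \<Sum>h'<H. u (t + h) * cnj (u (t + h')))" by (rule sum.swap)
    also have "\<dots> = (\<Sum>h<H. \<Sum>h'<H. c h h')"
      unfolding c_def by (rule sum.cong[OF refl]) (rule sum.swap)
    finally show ?thesis .
  qed
  then have "\<bar>\<Sum>t<N. norm (s t) ^ 2\<bar> = norm (\<Sum>h<H. \<Sum>h'<H. c h h')"
    by (metis norm_of_real)
  also have "\<dots> \<le> (\<Sum>h<H. \<Sum>h'<H. norm (c h h'))"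
    by (rule order_trans[OF norm_sum sum_mono]) (rule norm_sum)
  also have "\<dots> \<le> (\<Sum>h<H. \<Sum>h'<H. (if h' = h then real N else 0) + (\<eta> * N + 2 * H))"
    using c_eq c_ne \<open>\<eta> \<ge> 0\<close> by (intro sum_mono) (auto simp: add_increasing2)
  also have "\<dots> = real H * real N + real H^2 * (\<eta> * real N + 2 * real H)"
    by (simp add: sum.distrib power2_eq_square distrib_left)
  finally have S2: "(\<Sum>t<N. norm (s t) ^ 2) \<le> real H * real N + real H^2 * (\<eta> * real N + 2 * real H)" by linarith
  have "norm (\<Sum>t<N. s t) ^ 2 \<le> (\<Sum>t<N. norm (s t)) ^ 2"
    by (intro power_mono norm_sum) simp
  also have "\<dots> \<le> (\<Sum>t<N. norm (s t) ^ 2) * card {..<N}"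
    by (rule sum_squared_le_sum_of_squares)
  also have "\<dots> \<le> (real H * real N + real H^2 * (\<eta> * real N + 2 * real H)) * N"
    using S2 by (simp add: mult_right_mono)
  finally have "norm (\<Sum>t<N. s t) \<le> sqrt (real N * (real H * real N + real H^2 * (\<eta> * real N + 2 * real H)))"
    by (intro real_le_rsqrt) (simp add: mult.commute)
  moreover have "norm (of_nat H * (\<Sum>t<N. u t) - (\<Sum>t<N. s t)) \<le> 2 * real H^2"
  proof -
    have "(\<Sum>t<N. s t) = (\<Sum>h<H. \<Sum>t<N. u (t + h))" unfolding s_def by (rule sum.swap)
    then have "(\<Sum>t<N. s t) - of_nat H * (\<Sum>t<N. u t) = (\<Sum>h<H. (\<Sum>t<N. u (t + h)) - (\<Sum>t<N. u t))"
      by (simp add: sum_subtractf)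
    also have "norm \<dots> \<le> (\<Sum>h<H. 2 * real H)"
    proof (rule order_trans[OF norm_sum sum_mono])
      fix h assume "h \<in> {..<H}"
      then show "norm ((\<Sum>t<N. u (t + h)) - (\<Sum>t<N. u t)) \<le> 2 * real H"
        using order_trans[OF sum_shift_le[of u h N], of "2 * real H"] u by simp
    qed
    also have "\<dots> = 2 * real H^2" by (simp add: power2_eq_square)
    finally show ?thesis by (simp add: norm_minus_commute)
  qed
  moreover have "norm (of_nat H * (\<Sum>t<N. u t)) \<le> norm (\<Sum>t<N. s t) + norm (of_nat H * (\<Sum>t<N. u t) - (\<Sum>t<N. s t))"
    by (rule norm_triangle_sub)
  ultimately show ?thesis by (simp add: norm_mult)
qed

text \<open>A sequence whose short-range correlations are small has small means. It suffices to consider shifts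
  below a fixed \<open>H\<close>, which is what makes the periods in Weyl's theorem uniform.\<close>

lemma van_der_corput:
  fixes u :: "nat \<Rightarrow> complex" and \<eta> \<delta> :: real and H :: nat
  assumes u: "\<And>t. norm (u t) = 1"
    and corr: "\<And>b. b \<in> {1..<H} \<Longrightarrow>
      eventually (\<lambda>N. norm (\<Sum>t<N. u (t + b) * cnj (u t)) \<le> \<eta> * N) sequentially"
    and "\<eta> \<ge> 0" "H > 0" "\<delta> > 0" and small: "1 / H + \<eta> < \<delta>^2"
  shows "eventually (\<lambda>N. norm (\<Sum>t<N. u t) < \<delta> * N) sequentially"
proof -
  define c where "c = H^2 * \<delta>^2 - H - H^2 * \<eta>"
  define D where "D = 4 * real H^3 * \<delta> + 2 * real H^3"
  have "c = H^2 * (\<delta>^2 - (1 / H + \<eta>))"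
    using \<open>H > 0\<close> by (simp add: c_def field_simps power2_eq_square)
  then have c: "c > 0" using small \<open>H > 0\<close> by simp
  have "eventually (\<lambda>N. \<forall>b\<in>{1..<H}. norm (\<Sum>t<N. u (t + b) * cnj (u t)) \<le> \<eta> * N) sequentially"
    by (intro eventually_ball_finite) (use corr in auto)
  moreover have "eventually (\<lambda>N. real N > max (D / c) (2 * H / \<delta>)) sequentially"
    using filterlim_real_sequentially unfolding filterlim_at_top_dense by blast
  ultimately show ?thesis
  proof eventually_elim
    case (elim N)
    have N: "real N * c > D" "\<delta> * N > 2 * H"
      using elim(2) c \<open>\<delta> > 0\<close> by (simp_all add: field_simps)
    show ?case
    proof (rule ccontr)
      assume "\<not> norm (\<Sum>t<N. u t) < \<delta> * N"
      then have "H * (\<delta> * N) \<le> H * norm (\<Sum>t<N. u t)" by (intro mult_left_mono) auto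
      also have "\<dots> \<le> sqrt (real N * (real H * real N + real H^2 * (\<eta> * real N + 2 * real H))) + 2 * real H^2"
        by (rule van_der_corput_inequality) (use elim u \<open>\<eta> \<ge> 0\<close> in auto)
      finally have "H * (\<delta> * N) - 2 * real H^2
          \<le> sqrt (real N * (real H * real N + real H^2 * (\<eta> * real N + 2 * real H)))" by simp
      moreover have "0 \<le> H * (\<delta> * N) - 2 * real H^2"
      proof -
        have "real H * (2 * real H) \<le> real H * (\<delta> * real N)" using N(2) by (intro mult_left_mono) auto
        then show ?thesis by (simp add: power2_eq_square)
      qed
      ultimately have "(H * (\<delta> * N) - 2 * real H^2)^2
          \<le> N * (real H * real N + real H^2 * (\<eta> * real N + 2 * real H))"
        by (metis power_mono real_sqrt_ge_0_iff order_trans real_sqrt_pow2)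
      then have "N * (N * c) + 4 * real H ^ 4 \<le> N * D"
        by (simp add: c_def D_def power2_eq_square power3_eq_cube power4_eq_xxxx algebra_simps)
      moreover have "N * D \<le> N * (N * c)" using N(1) by (intro mult_left_mono) auto
      ultimately have "4 * real H ^ 4 \<le> 0" by linarith
      then show False using \<open>H > 0\<close> by simp
    qed
  qed
qed

definition unity :: "real \<Rightarrow> complex" where "unity x = cis (2 * pi * x)"

lemma norm_unity [simp]: "norm (unity x) = 1"
  by (simp add: unity_def)

lemma unity_add: "unity (x + y) = unity x * unity y"
  by (simp add: unity_def cis_mult distrib_left)

lemma unity_diff: "unity (x - y) = unity x * cnj (unity y)"
  by (simp add: unity_def cis_cnj cis_mult right_diff_distrib)

lemma unity_eq_1_iff: "unity x = 1 \<longleftrightarrow> x \<in> \<int>"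
proof
  assume "unity x = 1"
  then have "cos (2 * pi * x) = 1" by (simp add: unity_def complex_eq_iff)
  then obtain n :: int where "2 * pi * x = of_int n * 2 * pi"
    using cos_one_2pi_int by blast
  then have "x = of_int n" by simp
  then show "x \<in> \<int>" by simp
next
  assume "x \<in> \<int>"
  then obtain n where "x = of_int n" by (elim Ints_cases)
  then show "unity x = 1" by (simp add: unity_def cis_multiple_2pi)
qed

lemma unity_cong: "x - y \<in> \<int> \<Longrightarrow> unity x = unity y"
  using unity_add[of "x - y" y] unity_eq_1_iff[of "x - y"] by simp

text \<open>The exponential sums of a biased sequence do not become small: equidistribution modulo 1 fails at the
  first frequency.\<close>

definition biased :: "real \<Rightarrow> (int \<Rightarrow> real) \<Rightarrow> bool" where
  "biased \<delta> P \<longleftrightarrow> (\<exists>\<^sub>F N in sequentially. norm (\<Sum>t<N. unity (P (int t))) \<ge> \<delta> * N)"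

text \<open>Along progressions of step \<open>Q\<close>, \<open>P\<close> is affine modulo 1, with slopes \<open>R t\<close> that have period \<open>Q\<close>. If no slope
  were an integer, each exponential would be a \<open>Q\<close>-step difference of a bounded sequence \<open>z\<close> (as in the
  summation of a geometric series), and the exponential sums would stay bounded.\<close>

lemma biased_affine:
  assumes "\<delta> > 0" "Q > 0" "biased \<delta> P" "period_mod1 Q (\<lambda>t. P (t + int Q) - P t)"
  shows "\<exists>t. P (t + int Q) - P t \<in> \<int>"
proof (rule ccontr)
  assume non: "\<nexists>t. P (t + int Q) - P t \<in> \<int>"
  define R where "R t = P (t + int Q) - P t" for t
  define m where "m t = unity (R t) - 1" for t
  have m: "m t \<noteq> 0" for t using non by (auto simp: m_def R_def unity_eq_1_iff)
  have m_per: "m (t + int Q) = m t" for t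
    using unity_cong[of "R (t + int Q)" "R t"] assms(4) by (simp add: m_def R_def period_mod1_def)
  define z where "z t = unity (P t) / m t" for t
  have z: "unity (P t) = z (t + int Q) - z t" for t
  proof -
    have "unity (P (t + int Q)) = unity (R t) * unity (P t)"
      using unity_add[of "R t" "P t"] by (simp add: R_def)
    then have "unity (P (t + int Q)) - unity (P t) = unity (P t) * m t"
      by (simp add: m_def algebra_simps)
    moreover have "z (t + int Q) - z t = (unity (P (t + int Q)) - unity (P t)) / m t"
      by (simp add: z_def m_per diff_divide_distrib)
    ultimately show ?thesis using m[of t] by simp
  qed
  have m_mod: "m (int (j + k * Q)) = m (int j)" for j k
  proof (induction k)
    case (Suc k)
    then show ?case using m_per[of "int (j + k * Q)"] by (simp add: ac_simps)
  qed simp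
  define B where "B = (\<Sum>j<Q. 1 / norm (m (int j)))"
  have z_le: "norm (z (int t)) \<le> B" for t
  proof -
    have "norm (z (int t)) = 1 / norm (m (int (t mod Q)))"
      using m_mod[of "t mod Q" "t div Q"] by (simp add: z_def norm_divide)
    also have "\<dots> \<le> B"
      unfolding B_def by (rule member_le_sum[where f = "\<lambda>j. 1 / norm (m (int j))"]) (use \<open>Q > 0\<close> in auto)
    finally show ?thesis .
  qed
  have B: "B > 0"
    unfolding B_def using \<open>Q > 0\<close> m by (intro sum_pos) auto
  have bound: "norm (\<Sum>t<N. unity (P (int t))) \<le> 2 * Q * B" for N
  proof -
    define w where "w t = z (int t) / of_real B" for t
    have "norm ((\<Sum>t<N. w (t + Q)) - (\<Sum>t<N. w t)) \<le> 2 * real Q"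
      by (rule sum_shift_le) (use z_le B in \<open>simp add: w_def norm_divide\<close>)
    moreover have "(\<Sum>t<N. w (t + Q)) - (\<Sum>t<N. w t) = (\<Sum>t<N. unity (P (int t))) / of_real B"
      by (simp add: w_def z sum_subtractf diff_divide_distrib sum_divide_distrib)
    ultimately show ?thesis using B by (simp add: norm_divide field_simps)
  qed
  have "eventually (\<lambda>N. real N > 2 * Q * B / \<delta>) sequentially"
    using filterlim_real_sequentially unfolding filterlim_at_top_dense by blast
  then have "eventually (\<lambda>N. \<not> norm (\<Sum>t<N. unity (P (int t))) \<ge> \<delta> * N) sequentially"
  proof eventually_elim
    case (elim N)
    then have "2 * Q * B < \<delta> * N" using \<open>\<delta> > 0\<close> by (simp add: field_simps)
    then show ?case using bound[of N] by linarith
  qed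
  then show False using assms(3) by (simp add: biased_def frequently_def)
qed

text \<open>Weyl's theorem, with a period that depends only on the degree and the bias. By van der Corput and
  induction, for some \<open>b\<close> below a fixed bound the \<open>b\<close>-step difference of \<open>P\<close> has a bounded period; hence so
  does the \<open>Q\<close>-step difference \<open>R\<close>, for a suitable multiple \<open>Q\<close> of \<open>b\<close>, and \<open>P\<close> is affine along
  progressions of step \<open>Q\<close>. As \<open>P\<close> is biased, one value of \<open>R\<close> is an integer, and by
  \<open>periodic_poly_torsion\<close> all values of \<open>R\<close> are torsion of bounded order.\<close>

theorem weyl:
  assumes "\<delta> > 0"
  shows "\<exists>C>0. \<forall>P. poly_mod \<int> k P \<longrightarrow> biased \<delta> P \<longrightarrow> period_mod1 C P"
  using assms
proof (induction k arbitrary: \<delta>)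
  case 0
  show ?case by (intro exI[of _ 1]) (auto simp: period_mod1_def)
next
  case (Suc k)
  define \<eta> where "\<eta> = \<delta>^2 / 2"
  have \<eta>: "\<eta> > 0" using Suc.prems by (simp add: \<eta>_def)
  obtain C' where C': "C' > 0" "\<And>P. poly_mod \<int> k P \<Longrightarrow> biased \<eta> P \<Longrightarrow> period_mod1 C' P"
    using Suc.IH[OF \<eta>] by blast
  obtain H :: nat where H: "1 / \<eta> < real H" using reals_Archimedean2 by blast
  have Hpos: "H > 0" using H \<eta> by (metis divide_pos_pos of_nat_0_less_iff order_less_trans zero_less_one)
  have "1 / real H < \<eta>" using H \<eta> Hpos by (simp add: field_simps)
  then have small: "1 / H + \<eta> < \<delta>^2" by (simp add: \<eta>_def)
  \<comment> \<open>The factorial makes \<open>Q\<close> a multiple of the unknown shift \<open>b < H\<close>.\<close>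
  define Q where "Q = C' * fact H"
  have Q: "Q > 0" using C'(1) by (simp add: Q_def)
  show ?case
  proof (intro exI[of _ "Q * Q ^ k"] conjI allI impI)
    show "0 < Q * Q ^ k" using Q by simp
    fix P assume P: "poly_mod \<int> (Suc k) P" and bias: "biased \<delta> P"
    have "\<exists>b\<in>{1..<H}. biased \<eta> (\<lambda>t. P (t + int b) - P t)"
    proof (rule ccontr)
      assume no: "\<not> ?thesis"
      have "eventually (\<lambda>N. norm (\<Sum>t<N. unity (P (int t))) < \<delta> * N) sequentially"
      proof (rule van_der_corput[OF _ _ _ Hpos Suc.prems small])
        fix b assume "b \<in> {1..<H}"
        then have "\<not> biased \<eta> (\<lambda>t. P (t + int b) - P t)" using no by blast
        then have "eventually (\<lambda>N. norm (\<Sum>t<N. unity (P (int t + int b) - P (int t))) < \<eta> * N) sequentially"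
          by (simp add: biased_def frequently_def not_le)
        then show "eventually (\<lambda>N.
            norm (\<Sum>t<N. unity (P (int (t + b))) * cnj (unity (P (int t)))) \<le> \<eta> * N) sequentially"
          by eventually_elim (simp add: unity_diff)
      qed (use \<eta> in auto)
      then show False using bias by (simp add: biased_def frequently_def not_le)
    qed
    then obtain b where b: "b \<in> {1..<H}" "biased \<eta> (\<lambda>t. P (t + int b) - P t)" by blast
    have "period_mod1 C' (\<lambda>t. P (t + int b) - P t)"
      by (rule C'(2)[OF poly_mod_Ints_step[OF P] b(2)])
    then have pb: "period_mod1 Q (\<lambda>t. P (t + int b) - P t)" by (rule per1_dvd) (simp add: Q_def)
    have "b dvd fact H" using b(1) by (intro dvd_fact) auto
    then obtain j where j: "Q = j * b" by (metis Q_def dvd_def dvd_mult mult.commute)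
    define R where "R t = P (t + int Q) - P t" for t
    have "period_mod1 b R"
      unfolding period_mod1_def
    proof
      fix t
      have "P (t + int Q + int b) - P (t + int Q) - (P (t + int b) - P t) \<in> \<int>"
        using pb by (simp add: period_mod1_def)
      then show "R (t + int b) - R t \<in> \<int>" by (simp add: R_def algebra_simps)
    qed
    then have R: "period_mod1 Q R" by (rule per1_dvd) (simp add: j)
    obtain r where r: "R r \<in> \<int>"
      using biased_affine[OF Suc.prems Q bias R[unfolded R_def[abs_def]]] by (auto simp: R_def)
    have "of_nat (Q ^ k) * R t \<in> \<int>" for t
    proof -
      have "of_nat (Q ^ k) * (R t - R r) \<in> \<int>"
        by (rule periodic_poly_torsion[OF _ R]) (unfold R_def, rule poly_mod_Ints_step[OF P])
      from Ints_add[OF this Ints_mult[OF Ints_of_nat r, of "Q ^ k"]]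
      show ?thesis by (simp add: algebra_simps)
    qed
    moreover have "P (t + int (Q ^ k * Q)) - P t - of_nat (Q ^ k) * R t \<in> \<int>" for t
      using progression_affine[OF R[unfolded R_def[abs_def]], of t "Q ^ k"] by (simp only: R_def)
    ultimately have "P (t + int (Q ^ k * Q)) - P t \<in> \<int>" for t
      by (metis Ints_add diff_add_cancel)
    then show "period_mod1 (Q * Q ^ k) P" by (simp add: period_mod1_def mult.commute)
  qed
qed

text \<open>For \<open>\<theta>\<close> in \<open>[0, \<pi>]\<close> one has \<open>sin\<^sup>2 \<theta> \<le> sin \<theta>\<close>, so the means of \<open>exp (\<i> \<theta>)\<close> and
  \<open>exp (2 \<i> \<theta>)\<close> cannot both be small.
  Thus \<open>P\<close> or \<open>2 P\<close> is biased, and Weyl's theorem applies. The factor 2 cannot be avoided here: \<open>P\<close> may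
  take only the values \<open>0\<close> and \<open>1/2\<close>.\<close>

theorem half_range_periodic:
  "\<exists>C>0. \<forall>P. poly_mod \<int> k P \<longrightarrow> (\<forall>t. 0 \<le> P t \<and> P t \<le> 1 / 2) \<longrightarrow> period_mod1 C P"
proof -
  obtain C where C: "C > 0" "\<And>P. poly_mod \<int> k P \<Longrightarrow> biased (1 / 4) P \<Longrightarrow> period_mod1 C P"
    using weyl[of "1 / 4" k] by auto
  define Q where "Q = C * 2 ^ k"
  show ?thesis
  proof (intro exI[of _ "2 * Q"] conjI allI impI)
    show "0 < 2 * Q" using C(1) by (simp add: Q_def)
    fix P assume P: "poly_mod \<int> k P" and half: "\<forall>t. 0 \<le> P t \<and> P t \<le> 1 / 2"
    have "biased (1 / 4) P \<or> biased (1 / 4) (\<lambda>t. of_int 2 * P t)"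
    proof (rule ccontr)
      assume no: "\<not> ?thesis"
      have "eventually (\<lambda>N. norm (\<Sum>t<N. unity (P (int t))) < 1 / 4 * N) sequentially"
        "eventually (\<lambda>N. norm (\<Sum>t<N. unity (2 * P (int t))) < 1 / 4 * N) sequentially"
        using no by (simp_all add: biased_def frequently_def not_le)
      moreover have "eventually (\<lambda>N. N > 0) sequentially" by (rule eventually_gt_at_top)
      ultimately have "eventually (\<lambda>N. False) sequentially"
      proof eventually_elim
        case (elim N)
        define \<theta> where "\<theta> t = 2 * pi * P (int t)" for t
        have "(\<Sum>t<N. sin (\<theta> t)) \<le> norm (\<Sum>t<N. unity (P (int t)))"
          using abs_Im_le_cmod[of "\<Sum>t<N. unity (P (int t))"] by (simp add: unity_def \<theta>_def)
        then have s1: "(\<Sum>t<N. sin (\<theta> t)) < N / 4" using elim(1) by simp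
        have "(\<Sum>t<N. cos (2 * \<theta> t)) \<le> norm (\<Sum>t<N. unity (2 * P (int t)))"
          using abs_Re_le_cmod[of "\<Sum>t<N. unity (2 * P (int t))"] by (simp add: unity_def \<theta>_def mult_ac)
        then have s2: "(\<Sum>t<N. cos (2 * \<theta> t)) < N / 4" using elim(2) by simp
        \<comment> \<open>The left hand side is \<open>sin\<^sup>2\<close>.\<close>
        have "(1 - cos (2 * \<theta> t)) / 2 \<le> sin (\<theta> t)" for t
        proof -
          have "0 \<le> \<theta> t" "\<theta> t \<le> pi" using half mult_left_mono[of "P (int t)" "1 / 2" "2 * pi"]
            by (simp_all add: \<theta>_def)
          then have "0 \<le> sin (\<theta> t)" by (rule sin_ge_zero)
          then have "sin (\<theta> t) * sin (\<theta> t) \<le> sin (\<theta> t) * 1" by (intro mult_left_mono) auto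
          then show ?thesis by (simp add: cos_double_sin power2_eq_square)
        qed
        then have "(\<Sum>t<N. (1 - cos (2 * \<theta> t)) / 2) \<le> (\<Sum>t<N. sin (\<theta> t))" by (intro sum_mono)
        then have "(N - (\<Sum>t<N. cos (2 * \<theta> t))) / 2 \<le> (\<Sum>t<N. sin (\<theta> t))"
          by (simp add: sum_subtractf flip: sum_divide_distrib)
        then show False using s1 s2 elim(3) by simp
      qed
      then show False by simp
    qed
    then have "period_mod1 C (\<lambda>t. of_int 2 * P t)"
    proof
      assume "biased (1 / 4) P"
      then have c: "period_mod1 C P" using C(2) P by blast
      have "of_int 2 * P (t + int C) - of_int 2 * P t \<in> \<int>" for t
        using Ints_mult[of 2 "P (t + int C) - P t"] c by (simp add: period_mod1_def right_diff_distrib)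
      then show ?thesis by (simp add: period_mod1_def)
    next
      assume "biased (1 / 4) (\<lambda>t. of_int 2 * P t)"
      then show ?thesis using C(2) poly_mod_Ints_mult[OF P] by blast
    qed
    then have tors: "2 * (P (t + int C) - P t) \<in> \<int>" for t
      by (simp add: period_mod1_def right_diff_distrib)
    define D where "D t = P (t + int C) - P t" for t
    have "period_mod1 (2 ^ k) D"
      unfolding D_def by (rule torsion_poly_periodic[OF poly_mod_Ints_diff[OF poly_mod_shift[OF P] P]])
        (use tors in simp)
    then have DQ: "period_mod1 Q D" by (rule per1_dvd) (simp add: Q_def)
    have tors2: "2 * (P (t + int (j * C)) - P t) \<in> \<int>" for t j
    proof (induction j)
      case (Suc j)
      from Ints_add[OF tors[of "t + int (j * C)"] Suc] show ?case by (simp add: algebra_simps)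
    qed simp
    have "(P (t + int Q + int (j * C)) - P (t + int Q)) - (P (t + int (j * C)) - P t) \<in> \<int>" for t j
    proof (induction j)
      case (Suc j)
      have "D (t + int (j * C) + int Q) - D (t + int (j * C)) \<in> \<int>" using DQ by (simp add: period_mod1_def)
      from Ints_add[OF this Suc] show ?case by (simp add: D_def algebra_simps)
    qed simp
    from this[of _ "2 ^ k"] have "period_mod1 Q (\<lambda>t. P (t + int Q) - P t)"
      by (simp add: period_mod1_def Q_def mult.commute)
    then have "P (t + int (2 * Q)) - P t - of_nat 2 * (P (t + int Q) - P t) \<in> \<int>" for t
      by (rule progression_affine)
    moreover have "of_nat 2 * (P (t + int Q) - P t) \<in> \<int>" for t
      using tors2[of t "2 ^ k"] by (simp add: Q_def mult.commute)
    ultimately have "P (t + int (2 * Q)) - P t \<in> \<int>" for t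
      by (metis Ints_add diff_add_cancel)
    then show "period_mod1 (2 * Q) P" by (simp add: period_mod1_def)
  qed
qed

section \<open>Weak periodicity\<close>

text \<open>Each difference operator with step \<open>k i\<close> removes \<open>\<xi> i\<close> from the sum, and on \<open>\<psi>\<close> it acts like
  the difference operator with the common step \<open>h\<close>. After all \<open>\<xi> i\<close> are gone, the \<open>card V\<close>-th
  difference of \<open>\<psi>\<close> with step \<open>h\<close> lies in \<open>S\<close>.\<close>

lemma slice_poly:
  fixes \<psi> :: "Z2 \<Rightarrow> real" and \<xi> :: "'i \<Rightarrow> Z2 \<Rightarrow> real"
  assumes "finite V" and S: "\<And>x y. x \<in> S \<Longrightarrow> y \<in> S \<Longrightarrow> x - y \<in> S"
    and "\<And>x. \<psi> x + (\<Sum>i\<in>V. \<xi> i x) \<in> S"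
    and "\<And>i. i \<in> V \<Longrightarrow> has_period (k i) (\<xi> i)"
    and "\<And>i x. i \<in> V \<Longrightarrow> \<psi> (x + h) = \<psi> (x + k i)"
  shows "poly_mod S (card V) (\<lambda>t. \<psi> (x + t \<odot> h))"
  using assms(1,3-5)
proof (induction V arbitrary: \<psi> \<xi> x rule: finite_induct)
  case empty
  then show ?case by simp
next
  case (insert j V)
  define \<psi>' where "\<psi>' y = \<psi> (y + h) - \<psi> y" for y
  define \<xi>' where "\<xi>' i y = \<xi> i (y + k j) - \<xi> i y" for i y
  have "poly_mod S (card V) (\<lambda>t. \<psi>' (x + t \<odot> h))"
  proof (rule insert.IH)
    fix y
    have "\<psi>' y + (\<Sum>i\<in>V. \<xi>' i y)
        = (\<psi> (y + k j) + (\<Sum>i\<in>insert j V. \<xi> i (y + k j))) - (\<psi> y + (\<Sum>i\<in>insert j V. \<xi> i y))"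
      using insert.hyps perD[OF insert.prems(2)[of j], of y] insert.prems(3)[of j y]
      by (simp add: \<psi>'_def \<xi>'_def sum_subtractf)
    also have "\<dots> \<in> S" by (intro S insert.prems(1))
    finally show "\<psi>' y + (\<Sum>i\<in>V. \<xi>' i y) \<in> S" .
  next
    fix i assume i: "i \<in> V"
    show "has_period (k i) (\<xi>' i)"
      unfolding has_period_def
    proof
      fix y
      have "y + k i + k j = y + k j + k i" by simp
      then show "\<xi>' i (y + k i) = \<xi>' i y"
        unfolding \<xi>'_def using perD[OF insert.prems(2)[of i]] i by (metis insertI2)
    qed
    fix y
    have eq: "y + k i + h = y + h + k i" by simp
    show "\<psi>' (y + h) = \<psi>' (y + k i)"
      unfolding \<psi>'_def eq using insert.prems(3)[of i] i by simp
  qed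
  moreover have "\<psi>' (x + t \<odot> h) = \<psi> (x + (t + 1) \<odot> h) - \<psi> (x + t \<odot> h)" for t
    by (simp add: \<psi>'_def smult_add_left add.assoc)
  ultimately show ?case using insert.hyps by simp
qed

lemma bounded_poly_constant:
  assumes "poly_mod {0} k P" and "\<And>t. \<bar>P t\<bar> \<le> B"
  shows "P (t + 1) = P t"
  using assms
proof (induction k arbitrary: P B t)
  case 0
  then show ?case by simp
next
  case (Suc k)
  define D where "D t = P (t + 1) - P t" for t
  have "D (s + 1) = D s" for s
  proof (rule Suc.IH)
    show "poly_mod {0} k D" using Suc.prems(1) by (simp add: D_def[abs_def])
    show "\<bar>D t\<bar> \<le> 2 * B" for t
      using Suc.prems(2)[of t] Suc.prems(2)[of "t + 1"] by (simp add: D_def)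
  qed
  then have D: "D (t + int n) = D t" for n
    by (induction n) (simp_all add: add.assoc[symmetric] add.commute[of 1])
  have P: "P (t + int n) = P t + n * D t" for n
  proof (induction n)
    case (Suc n)
    have "P (t + int n + 1) = P (t + int n) + D (t + int n)" by (simp add: D_def)
    then show ?case using Suc D by (simp add: algebra_simps)
  qed simp
  have "D t = 0"
  proof (rule ccontr)
    assume "D t \<noteq> 0"
    obtain n :: nat where "2 * B / \<bar>D t\<bar> < n" using reals_Archimedean2 by blast
    then have "2 * B < n * \<bar>D t\<bar>" using \<open>D t \<noteq> 0\<close> by (simp add: field_simps)
    also have "n * \<bar>D t\<bar> = \<bar>P (t + int n) - P t\<bar>" by (simp add: P abs_mult)
    also have "\<dots> \<le> 2 * B" using Suc.prems(2)[of t] Suc.prems(2)[of "t + int n"] by simp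
    finally show False by simp
  qed
  then show ?case by (simp add: D_def)
qed

lemma per_indicatorD:
  assumes "has_period h (indicator B :: Z2 \<Rightarrow> real)"
  shows "x + h \<in> B \<longleftrightarrow> x \<in> B"
  using perD[OF assms, of x] by (cases "x \<in> B"; cases "x + h \<in> B") simp_all

lemma per_indicatorI:
  assumes "\<And>m x. x \<in> B \<Longrightarrow> x + m \<odot> h \<in> B"
  shows "has_period h (indicator B :: Z2 \<Rightarrow> real)"
  unfolding has_period_def
proof
  fix x
  have "x + h \<in> B" if "x \<in> B" using assms[OF that, of 1] by simp
  moreover have "x \<in> B" if "x + h \<in> B" using assms[OF that, of "-1"] by (simp add: smult_minus)
  ultimately show "indicator B (x + h) = (indicator B x :: real)" by (auto simp: indicator_def)
qed

lemma span_multiple: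
  assumes "det2 w w' dvd \<Delta>"
  obtains a b where "(L * \<Delta> * c) \<odot> z = a \<odot> L \<odot> w + b \<odot> L \<odot> w'"
proof -
  obtain k where k: "\<Delta> = det2 w w' * k" using assms by (elim dvdE)
  have "(L * \<Delta> * c) \<odot> z = (L * k * c) \<odot> (det2 w w' \<odot> z)" by (simp add: k ac_simps)
  also have "\<dots> = (L * k * c) \<odot> (det2 z w' \<odot> w + det2 w z \<odot> w')"
    by (simp only: cramer[of w w' z])
  also have "\<dots> = (k * c * det2 z w') \<odot> L \<odot> w + (k * c * det2 w z) \<odot> L \<odot> w'"
    by (simp add: smult_add_right ac_simps)
  finally show ?thesis by (rule that)
qed

text \<open>The functions \<open>e w\<close> add up to a periodic function, so \<open>slice_poly\<close> makes each of them a polynomial along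
  progressions in \<open>L \<Delta> c \<int>\<^sup>2\<close>, without any reduction modulo 1; a bounded polynomial is constant. The
  index 0, which is not in \<open>U\<close>, carries the summand that is already doubly periodic.\<close>

lemma pieces_doubly_periodic:
  fixes e :: "Z2 \<Rightarrow> Z2 \<Rightarrow> real"
  assumes fin: "finite U" and U0: "0 \<notin> U"
    and indep: "\<And>w w'. w \<in> U \<Longrightarrow> w' \<in> U \<Longrightarrow> w \<noteq> w' \<Longrightarrow> det2 w w' dvd \<Delta>"
    and has_period: "\<And>w. w \<in> U \<Longrightarrow> has_period (L \<odot> w) (e w)"
    and per0: "\<And>z. has_period ((L * \<Delta> * c) \<odot> z) (e 0)"
    and total: "\<And>z. has_period ((L * \<Delta> * c) \<odot> z) (\<lambda>x. \<Sum>w\<in>insert 0 U. e w x)"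
    and bound: "\<And>w x. w \<in> U \<Longrightarrow> \<bar>e w x\<bar> \<le> K"
    and w: "w \<in> U"
  shows "has_period ((L * \<Delta> * c) \<odot> z) (e w)"
  unfolding has_period_def
proof
  fix x
  define h where "h = (L * \<Delta> * c) \<odot> z"
  have "\<exists>a b. h = a \<odot> L \<odot> w + b \<odot> L \<odot> w'" if "w' \<in> U - {w}" for w'
    unfolding h_def using span_multiple[of w w' \<Delta>] indep w that by (metis DiffE insertI1)
  then obtain a b where ab: "\<And>w'. w' \<in> U - {w} \<Longrightarrow> h = a w' \<odot> L \<odot> w + b w' \<odot> L \<odot> w'"
    by metis
  \<comment> \<open>The index 0 stands for the doubly periodic summand minus the total; the step \<open>h\<close> removes it.\<close>
  define V where "V = insert 0 (U - {w})"
  define \<xi> where "\<xi> w' = (if w' = 0 then (\<lambda>x. e 0 x - (\<Sum>w\<in>insert 0 U. e w x)) else e w')" for w'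
  define k where "k w' = (if w' = 0 then h else b w' \<odot> L \<odot> w')" for w'
  have "poly_mod {0} (card V) (\<lambda>t. e w (x + t \<odot> h))"
  proof (rule slice_poly)
    show "finite V" using fin by (simp add: V_def)
    show "e w y + (\<Sum>i\<in>V. \<xi> i y) \<in> {0}" for y
    proof -
      have "(\<Sum>i\<in>V. \<xi> i y) = \<xi> 0 y + (\<Sum>i\<in>U - {w}. e i y)"
      proof -
        have "\<xi> i = e i" if "i \<in> U" for i using U0 that by (simp add: \<xi>_def) metis
        then have "(\<Sum>i\<in>U - {w}. \<xi> i y) = (\<Sum>i\<in>U - {w}. e i y)" by (intro sum.cong refl) simp
        then show ?thesis unfolding V_def using fin U0 by simp
      qed
      moreover have "(\<Sum>w\<in>insert 0 U. e w y) = e 0 y + (e w y + (\<Sum>i\<in>U - {w}. e i y))"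
        using fin U0 w by (simp add: sum.remove)
      ultimately show ?thesis by (simp add: \<xi>_def)
    qed
    show "has_period (k i) (\<xi> i)" if "i \<in> V" for i
    proof (cases "i = 0")
      case True
      then show ?thesis
        using per0[of z] total[of z] by (simp add: \<xi>_def k_def h_def has_period_def)
    next
      case False
      then show ?thesis using that per_smult[OF has_period] by (simp add: \<xi>_def k_def V_def)
    qed
    show "e w (y + h) = e w (y + k i)" if "i \<in> V" for i y
    proof (cases "i = 0")
      case False
      then have "h = a i \<odot> L \<odot> w + k i" using ab[of i] that by (simp add: k_def V_def)
      then have "y + h = y + k i + a i \<odot> L \<odot> w" by simp
      then show ?thesis using perD[OF per_smult[OF has_period[OF w]]] by metis
    qed (simp add: k_def)
  qed auto
  then have "e w (x + (0 + 1) \<odot> h) = e w (x + 0 \<odot> h)"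
    by (rule bounded_poly_constant) (rule bound[OF w])
  then show "e w (x + (L * \<Delta> * c) \<odot> z) = e w x" by (simp add: h_def)
qed

text \<open>The splitting of a tiling into singly periodic pieces, in terms of the functions obtained by averaging.
  The three steps are the crossing inequality \<open>cross\<close>, the constancy \<open>const\<close> of every \<open>\<phi> w\<close> modulo 1 on
  cosets of \<open>N \<int>\<^sup>2\<close>, and once more the crossing inequality \<open>crossN\<close>, now for functions with values 0
  and 1.\<close>

theorem weak_periodicity:
  fixes \<phi> :: "Z2 \<Rightarrow> Z2 \<Rightarrow> real"
  assumes fin: "finite U" and U0: "0 \<notin> U"
    and indep: "\<And>w w'. w \<in> U \<Longrightarrow> w' \<in> U \<Longrightarrow> w \<noteq> w' \<Longrightarrow> det2 w w' dvd \<Delta>"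
    and nonneg: "\<And>w x. w \<in> U \<Longrightarrow> 0 \<le> \<phi> w x"
    and has_period: "\<And>w. w \<in> U \<Longrightarrow> has_period (L \<odot> w) (\<phi> w)"
    and total: "\<And>x. indicator A x + (\<Sum>w\<in>U. \<phi> w x) = indicator E x"
    and perE: "\<And>z. has_period (L \<odot> z) (indicator E :: Z2 \<Rightarrow> real)"
    and C: "\<And>P. poly_mod \<int> (card U) P \<Longrightarrow> (\<forall>t. 0 \<le> P t \<and> P t \<le> 1 / 2) \<Longrightarrow> period_mod1 C P"
  obtains B where
    "\<And>w. w \<in> U \<Longrightarrow> has_period (L \<odot> w) (indicator (B w) :: Z2 \<Rightarrow> real)"
    "\<And>z. has_period ((L * \<Delta> * int C) \<odot> z) (indicator (B 0) :: Z2 \<Rightarrow> real)"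
    "\<And>x. (\<Sum>w\<in>insert 0 U. indicator (B w) x :: real) = indicator A x"
proof -
  define N where "N = L * \<Delta> * int C"
  have single_le: "\<phi> w x \<le> indicator E x - indicator A x" if "w \<in> U" for w x
  proof -
    have "\<phi> w x \<le> (\<Sum>w\<in>U. \<phi> w x)" using fin that nonneg by (intro member_le_sum) auto
    then show ?thesis using total[of x] by simp
  qed
  have pair_le: "\<phi> w x + \<phi> w' x \<le> 1" if "w \<in> U" "w' \<in> U" "w \<noteq> w'" for w w' x
  proof -
    have "(\<Sum>w\<in>{w, w'}. \<phi> w x) \<le> (\<Sum>w\<in>U. \<phi> w x)"
      using fin that nonneg by (intro sum_mono2) auto
    also have "\<dots> \<le> 1" using total[of x] by (cases "x \<in> A"; cases "x \<in> E") simp_all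
    finally show ?thesis using that by simp
  qed
  have cross: "\<phi> w y + \<phi> w' (y + (L * \<Delta> * c) \<odot> z) \<le> 1"
    if ww: "w \<in> U" "w' \<in> U" "w \<noteq> w'" for w w' y c z
  proof -
    obtain a b where ab: "(L * \<Delta> * c) \<odot> z = a \<odot> L \<odot> w + b \<odot> L \<odot> w'"
      using span_multiple[OF indep[OF ww], of L c z] by blast
    define p where "p = y + a \<odot> L \<odot> w"
    have "\<phi> w p = \<phi> w y" unfolding p_def by (rule perD[OF per_smult[OF has_period[OF ww(1)]]])
    moreover have "y + (L * \<Delta> * c) \<odot> z = p + b \<odot> L \<odot> w'" by (simp add: ab p_def)
    then have "\<phi> w' (y + (L * \<Delta> * c) \<odot> z) = \<phi> w' p"
      using perD[OF per_smult[OF has_period[OF ww(2)]]] by metis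
    ultimately show ?thesis using pair_le[OF ww, of p] by simp
  qed
  \<comment> \<open>Modulo the period \<open>L \<odot> w\<close> of \<open>\<phi> w\<close>, the step is a multiple of \<open>L \<odot> w'\<close>, for every other \<open>w'\<close>.\<close>
  have poly: "poly_mod \<int> (card U) (\<lambda>t. \<phi> w (x + t \<odot> (L * \<Delta>) \<odot> z))" if w: "w \<in> U" for w x z
  proof -
    define h where "h = (L * \<Delta>) \<odot> z"
    have "\<exists>a b. h = a \<odot> L \<odot> w + b \<odot> L \<odot> w'" if "w' \<in> U - {w}" for w'
      unfolding h_def using span_multiple[of w w' \<Delta> L 1] indep w that by (metis DiffE insertI1 mult.right_neutral)
    then obtain a b where ab: "\<And>w'. w' \<in> U - {w} \<Longrightarrow> h = a w' \<odot> L \<odot> w + b w' \<odot> L \<odot> w'"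
      by metis
    have "poly_mod \<int> (card (U - {w})) (\<lambda>t. \<phi> w (x + t \<odot> h))"
    proof (rule slice_poly[where \<xi> = \<phi> and k = "\<lambda>w'. b w' \<odot> L \<odot> w'"])
      show "\<phi> w y + (\<Sum>i\<in>U - {w}. \<phi> i y) \<in> \<int>" for y
      proof -
        have "\<phi> w y + (\<Sum>i\<in>U - {w}. \<phi> i y) = indicator E y - indicator A y"
          using total[of y] fin w by (simp add: sum.remove)
        then show ?thesis by (simp add: indicator_def)
      qed
      show "has_period (b i \<odot> L \<odot> i) (\<phi> i)" if "i \<in> U - {w}" for i
        using that by (intro per_smult has_period) auto
      show "\<phi> w (y + h) = \<phi> w (y + b i \<odot> L \<odot> i)" if "i \<in> U - {w}" for i y
      proof -
        have "y + h = y + b i \<odot> L \<odot> i + a i \<odot> L \<odot> w" using ab[OF that] by simp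
        then show ?thesis using perD[OF per_smult[OF has_period[OF w]]] by metis
      qed
    qed (use fin in auto)
    then show ?thesis unfolding h_def by (rule poly_mod_Ints_le[rotated]) (simp add: card_Diff1_le)
  qed
  have small: "\<phi> w (x + N \<odot> z) - \<phi> w x \<in> \<int>"
    if w: "w \<in> U" and half: "\<And>t. \<phi> w (x + (L * \<Delta> * t) \<odot> z) \<le> 1 / 2" for w x z
  proof -
    have "period_mod1 C (\<lambda>t. \<phi> w (x + t \<odot> (L * \<Delta>) \<odot> z))"
      by (rule C[OF poly[OF w]]) (use nonneg w half in \<open>simp add: ac_simps\<close>)
    then have "\<phi> w (x + (0 + int C) \<odot> (L * \<Delta>) \<odot> z) - \<phi> w (x + 0 \<odot> (L * \<Delta>) \<odot> z) \<in> \<int>"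
      unfolding period_mod1_def by blast
    then show ?thesis by (simp add: N_def ac_simps)
  qed
  have const: "\<phi> w (x + N \<odot> z) - \<phi> w x \<in> \<int>" if w: "w \<in> U" for w x z
  proof (cases "\<forall>t. \<phi> w (x + (L * \<Delta> * t) \<odot> z) \<le> 1 / 2")
    case True
    then show ?thesis using small[OF w] by blast
  next
    case False
    then obtain s where s: "\<phi> w (x + (L * \<Delta> * s) \<odot> z) > 1 / 2" by (auto simp: not_le)
    \<comment> \<open>By crossing, all other functions are at most \<open>1/2\<close>; their periodicity forces that of \<open>\<phi> w\<close>.\<close>
    have other: "\<phi> i (x + N \<odot> z) - \<phi> i x \<in> \<int>" if i: "i \<in> U - {w}" for i
    proof (rule small)
      fix t
      have eq: "x + (L * \<Delta> * s) \<odot> z + (L * \<Delta> * (t - s)) \<odot> z = x + (L * \<Delta> * t) \<odot> z"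
        by (simp add: prod_eq_iff algebra_simps)
      have "w \<noteq> i" "i \<in> U" using i by auto
      then show "\<phi> i (x + (L * \<Delta> * t) \<odot> z) \<le> 1 / 2"
        using cross[of w i "x + (L * \<Delta> * s) \<odot> z" "t - s" z, unfolded eq] s w by simp
    qed (use i in simp)
    have eq: "\<phi> w y = indicator E y - indicator A y - (\<Sum>i\<in>U - {w}. \<phi> i y)" for y
      using total[of y] fin w by (simp add: sum.remove)
    have "\<phi> w (x + N \<odot> z) - \<phi> w x = (indicator E (x + N \<odot> z) - indicator A (x + N \<odot> z))
        - (indicator E x - indicator A x) - (\<Sum>i\<in>U - {w}. \<phi> i (x + N \<odot> z) - \<phi> i x)"
      by (simp add: eq sum_subtractf)
    also have "\<dots> \<in> \<int>"
      by (intro Ints_diff Ints_sum other) (auto simp: indicator_def)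
    finally show ?thesis .
  qed
  have zero: "\<phi> w x = 0" if "x \<in> A" "w \<in> U" for w x
    using single_le[of w x] nonneg[of w x] that by (cases "x \<in> E") simp_all
  have AE: "x \<in> E" if "x \<in> A" for x
  proof -
    have "(\<Sum>w\<in>U. \<phi> w x) \<ge> 0" by (intro sum_nonneg nonneg)
    then show ?thesis using total[of x] that by (cases "x \<in> E") simp_all
  qed
  have inA: "x \<in> A" if "x \<in> E" "\<And>w. w \<in> U \<Longrightarrow> \<phi> w x = 0" for x
    using total[of x] that by (cases "x \<in> A") simp_all
  have inE: "x + (L * m) \<odot> z \<in> E \<longleftrightarrow> x \<in> E" for x m z
    using per_indicatorD[OF perE[of "m \<odot> z"], of x] by simp
  have one: "\<phi> w (x + N \<odot> z) \<ge> 1" if "x \<in> A" "w \<in> U" "\<phi> w (x + N \<odot> z) \<noteq> 0" for w x z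
  proof -
    have "\<phi> w (x + N \<odot> z) \<in> \<int>" using const[of w x z] zero that by simp
    then obtain i :: int where i: "\<phi> w (x + N \<odot> z) = of_int i" by (elim Ints_cases)
    then show ?thesis using nonneg[of w "x + N \<odot> z"] that by simp
  qed
  have crossN: "\<phi> w' (x + N \<odot> z') = 0"
    if "w \<in> U" "w' \<in> U" "w \<noteq> w'" "\<phi> w (x + N \<odot> z) \<ge> 1" for w w' x z z'
  proof -
    have eq: "x + N \<odot> z + (L * \<Delta> * int C) \<odot> (z' - z) = x + N \<odot> z'"
      by (simp add: N_def smult_diff_right)
    show ?thesis
      using cross[of w w' "x + N \<odot> z" "int C" "z' - z", unfolded eq] nonneg[of w' "x + N \<odot> z'"] that by simp
  qed
  \<comment> \<open>A point of \<open>A\<close> belongs to the direction whose function is not zero on its coset, if there is one.\<close>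
  define B where "B w = {x \<in> A. if w = 0 then \<forall>w\<in>U. \<forall>z. \<phi> w (x + N \<odot> z) = 0
      else \<exists>z. \<phi> w (x + N \<odot> z) \<noteq> 0}" for w
  show ?thesis
  proof
    show "has_period (L \<odot> w) (indicator (B w) :: Z2 \<Rightarrow> real)" if w: "w \<in> U" for w
    proof (rule per_indicatorI)
      fix m x assume x: "x \<in> B w"
      have w0: "w \<noteq> 0" using w U0 by auto
      obtain z where z: "x \<in> A" "\<phi> w (x + N \<odot> z) \<noteq> 0" using x w0 by (simp add: B_def) blast
      define x' where "x' = x + m \<odot> L \<odot> w"
      have perw: "\<phi> w (y + m \<odot> L \<odot> w) = \<phi> w y" for y by (rule perD[OF per_smult[OF has_period[OF w]]])
      have "x' + N \<odot> z = x + N \<odot> z + m \<odot> L \<odot> w" by (simp add: x'_def)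
      then have xz: "\<phi> w (x' + N \<odot> z) = \<phi> w (x + N \<odot> z)" using perw by metis
      have "\<phi> w' x' = 0" if "w' \<in> U" for w'
      proof (cases "w' = w")
        case True
        then show ?thesis using perw zero[OF z(1) w] by (simp add: x'_def)
      next
        case False
        then show ?thesis
          using crossN[of w w' x' z 0] w that one[OF z(1) w z(2)] xz by simp
      qed
      moreover have "x' \<in> E" using inE[of x m w] AE[OF z(1)] by (simp add: x'_def mult.commute)
      ultimately have "x' \<in> A" using inA by blast
      then have "x' \<in> B w" using xz z(2) w0 by (simp add: B_def) metis
      then show "x + m \<odot> L \<odot> w \<in> B w" by (simp only: x'_def)
    qed
    have "has_period (N \<odot> z) (indicator (B 0) :: Z2 \<Rightarrow> real)" for z
    proof (rule per_indicatorI)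
      fix m x assume x: "x \<in> B 0"
      have phi0: "\<phi> w (x + m \<odot> N \<odot> z + N \<odot> z') = 0" if "w \<in> U" for w z'
      proof -
        have eq: "x + m \<odot> N \<odot> z + N \<odot> z' = x + N \<odot> (m \<odot> z + z')"
          by (simp add: smult_add_right ac_simps)
        show ?thesis unfolding eq using x that by (simp add: B_def)
      qed
      have "m \<odot> N \<odot> z = (L * (m * \<Delta> * int C)) \<odot> z" by (simp add: N_def ac_simps)
      moreover have "x \<in> E" using x AE by (simp add: B_def)
      ultimately have "x + m \<odot> N \<odot> z \<in> E" using inE by metis
      then have "x + m \<odot> N \<odot> z \<in> A" using inA phi0[of _ 0] by simp
      then show "x + m \<odot> N \<odot> z \<in> B 0" using phi0 by (simp add: B_def)
    qed
    then show "has_period ((L * \<Delta> * int C) \<odot> z) (indicator (B 0) :: Z2 \<Rightarrow> real)" for z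
      by (simp add: N_def)
    show "(\<Sum>w\<in>insert 0 U. indicator (B w) x :: real) = indicator A x" for x
    proof (cases "x \<in> A")
      case False
      then show ?thesis by (simp add: B_def)
    next
      case True
      have "\<exists>w0\<in>insert 0 U. \<forall>w\<in>insert 0 U. x \<in> B w \<longleftrightarrow> w = w0"
      proof (cases "\<exists>w\<in>U. \<exists>z. \<phi> w (x + N \<odot> z) \<noteq> 0")
        case True
        then obtain w z where w: "w \<in> U" "\<phi> w (x + N \<odot> z) \<noteq> 0" by blast
        have "\<phi> w' (x + N \<odot> z') = 0" if "w' \<in> U" "w' \<noteq> w" for w' z'
          using crossN[of w w' x z z'] one[OF \<open>x \<in> A\<close> w] w that by blast
        then show ?thesis using w U0 \<open>x \<in> A\<close> by (intro bexI[of _ w]) (auto simp: B_def)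
      next
        case False
        then show ?thesis using \<open>x \<in> A\<close> U0 by (intro bexI[of _ 0]) (auto simp: B_def)
      qed
      then obtain w0 where w0: "w0 \<in> insert 0 U" "\<forall>w\<in>insert 0 U. x \<in> B w \<longleftrightarrow> w = w0"
        by (elim bexE)
      then have "(\<Sum>w\<in>insert 0 U. indicator (B w) x :: real) = (\<Sum>w\<in>insert 0 U. if w = w0 then 1 else 0)"
        by (intro sum.cong refl) (simp only: indicator_def of_bool_def)
      also have "\<dots> = 1" using fin w0(1) by (simp only: sum.delta finite_insert if_True)
      finally show ?thesis using True by simp
    qed
  qed
qed

section \<open>Making a singly periodic tiling doubly periodic\<close>

text \<open>A nonzero coordinate of a nonzero vector, chosen in the same way for parallel vectors; so \<open>v\<close> and \<open>w\<close> are
  parallel if and only if the rational vectors \<open>v / coord v\<close> and \<open>w / coord w\<close> agree.\<close>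

definition coord :: "Z2 \<Rightarrow> int" where
  "coord v = (if fst v \<noteq> 0 then fst v else snd v)"

lemma coord_nonzero: "v \<noteq> 0 \<Longrightarrow> coord v \<noteq> 0"
  by (auto simp: coord_def prod_eq_iff)

lemma coord_parallel:
  assumes "det2 v w = 0" "v \<noteq> 0"
  shows "coord v \<odot> w = coord w \<odot> v"
proof (cases "fst v = 0")
  case True
  then have "snd v \<noteq> 0" using assms(2) by (auto simp: prod_eq_iff)
  then have "fst w = 0" using assms(1) True by (simp add: det2_def)
  then show ?thesis using True by (simp add: coord_def prod_eq_iff)
next
  case False
  then have "fst w = 0 \<Longrightarrow> snd w = 0" using assms(1) by (simp add: det2_def)
  then show ?thesis using False assms(1) by (auto simp: coord_def prod_eq_iff det2_def mult.commute)
qed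

lemma smult_cancel: "k \<noteq> 0 \<Longrightarrow> k \<odot> v = k \<odot> w \<longleftrightarrow> v = w"
  by (simp add: prod_eq_iff)

lemma per_dvd: assumes "has_period (k \<odot> v) g" "k dvd m" shows "has_period (m \<odot> v) g"
proof -
  obtain j where "m = j * k" using assms(2) by (metis dvdE mult.commute)
  then show ?thesis using per_smult[OF assms(1), of j] by simp
qed

lemma per_sum: "(\<And>i. i \<in> I \<Longrightarrow> has_period h (g i)) \<Longrightarrow> has_period h (\<lambda>x. \<Sum>i\<in>I. g i x)"
  by (simp add: has_period_def)

lemma per_translate: "has_period h g \<Longrightarrow> has_period h (\<lambda>x. g (x - y))"
  unfolding has_period_def by (metis add_diff_eq diff_add_eq)

lemma per_parallel:
  assumes "has_period (L \<odot> w) g" "det2 w v = 0" "w \<noteq> 0" "L * coord w dvd Y"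
  shows "has_period (Y \<odot> v) g"
proof -
  obtain k where k: "Y = L * coord w * k" using assms(4) by (elim dvdE)
  have "Y \<odot> v = (L * k) \<odot> (coord w \<odot> v)" by (simp add: k ac_simps)
  also have "\<dots> = (k * coord v) \<odot> (L \<odot> w)"
    by (simp only: coord_parallel[OF assms(2,3)]) (simp add: ac_simps)
  finally show ?thesis using per_smult[OF assms(1)] by simp
qed

text \<open>Averaging the dilated tilings by \<open>F - f0\<close> keeps the terms with \<open>f - f0\<close> parallel to \<open>w\<close>, as there the
  dilation moves \<open>A\<close> by one of its periods. Every other term acquires the period \<open>Y (f - f0)\<close> in addition to
  \<open>Y w\<close>, so it is doubly periodic; and so is what remains when these terms are subtracted from \<open>e\<close>.\<close>

lemma parallel_part_periodic:
  fixes e :: "Z2 \<Rightarrow> real"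
  assumes fin: "finite F" and f0: "f0 \<in> F" and w0: "w \<noteq> 0"
    and perA: "has_period (L \<odot> w) (indicator A :: Z2 \<Rightarrow> real)"
    and tile: "\<And>x. (\<Sum>f\<in>F. indicator A (x - f)) = e x"
    and pere: "\<And>z. has_period (N \<odot> z) e"
    and Y: "N dvd Y" "fact (card F) dvd Y" "L * coord w dvd Y" "Y > 0"
    and P: "Y dvd P" "\<And>f. f \<in> F \<Longrightarrow> det2 w (f - f0) \<noteq> 0 \<Longrightarrow> Y * det2 w (f - f0) dvd P"
  shows "has_period (P \<odot> z) (\<lambda>x. \<Sum>f | f \<in> F \<and> det2 w (f - f0) = 0. indicator A (x - (f - f0)) :: real)"
proof -
  define e' where "e' x = e (x + f0)" for x
  have pere': "has_period (N \<odot> z) e'" for z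
    unfolding e'_def using per_translate[OF pere, of z "- f0"] by simp
  have tile': "(\<Sum>f\<in>F. indicator A (x - (f - f0))) = e' x" for x
    using tile[of "x + f0"] by (simp add: e'_def algebra_simps)
  have "(\<Sum>f\<in>F. indicator A (x - (1 + int s * Y) \<odot> (f - f0))) = e' x" for s x
    by (rule dilation[OF fin tile' pere' Y(1,2,4)])
  then obtain \<phi> :: "Z2 \<Rightarrow> Z2 \<Rightarrow> real" where \<phi>:
    "\<And>x. (\<Sum>f\<in>F. \<phi> f x) = e' x"
    "\<And>f. f \<in> F \<Longrightarrow> has_period (Y \<odot> (f - f0)) (\<phi> f)"
    "\<And>f h. f \<in> F \<Longrightarrow> has_period h (indicator A :: Z2 \<Rightarrow> real) \<Longrightarrow> has_period h (\<phi> f)"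
    "\<And>f x. f \<in> F \<Longrightarrow> has_period (Y \<odot> (f - f0)) (indicator A :: Z2 \<Rightarrow> real) \<Longrightarrow> \<phi> f x = indicator A (x - (f - f0))"
    by (rule averaging[OF fin]) blast
  define S where "S = {f \<in> F. det2 w (f - f0) = 0}"
  have "(\<Sum>f\<in>S. indicator A (x - (f - f0))) = e' x - (\<Sum>f\<in>F - S. \<phi> f x)" for x
  proof -
    have "(\<Sum>f\<in>S. indicator A (x - (f - f0))) = (\<Sum>f\<in>S. \<phi> f x)"
      using \<phi>(4) per_parallel[OF perA _ w0 Y(3)] by (intro sum.cong refl) (simp add: S_def)
    moreover have "(\<Sum>f\<in>F. \<phi> f x) = (\<Sum>f\<in>F - S. \<phi> f x) + (\<Sum>f\<in>S. \<phi> f x)"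
      by (rule sum.subset_diff[OF _ fin]) (simp add: S_def)
    ultimately show ?thesis using \<phi>(1)[of x] by simp
  qed
  moreover have "has_period (P \<odot> z) (\<phi> f)" if "f \<in> F - S" for f
  proof -
    have f: "f \<in> F" "det2 w (f - f0) \<noteq> 0" using that by (auto simp: S_def)
    obtain k where k: "P = Y * det2 w (f - f0) * k" using P(2)[OF f] by (elim dvdE)
    obtain a b where ab: "P \<odot> z = a \<odot> Y \<odot> w + b \<odot> Y \<odot> (f - f0)"
      unfolding k by (rule span_multiple[OF dvd_refl])
    have "L dvd Y" using Y(3) dvd_mult_left by blast
    then have "has_period (Y \<odot> w) (\<phi> f)" using per_dvd[OF \<phi>(3)[OF f(1) perA]] by blast
    then show ?thesis unfolding ab by (rule per_add[OF per_smult per_smult[OF \<phi>(2)[OF f(1)]]])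
  qed
  then have "has_period (P \<odot> z) (\<lambda>x. \<Sum>f\<in>F - S. \<phi> f x)" by (rule per_sum)
  moreover have "has_period (P \<odot> z) e'"
    using per_dvd[OF pere'] Y(1) P(1) dvd_trans by blast
  ultimately show ?thesis by (simp add: has_period_def S_def)
qed

text \<open>The columns, that is the lines parallel to \<open>w\<close>, are indexed by \<open>det2 w\<close>. Two columns are equivalent if a
  translation in \<open>P \<int>\<^sup>2\<close> maps one to the other, \<open>\<rho>\<close> picks a column from each class, and the translation by
  \<open>P \<odot> s c\<close> maps the column \<open>c\<close> to \<open>\<rho> c\<close>. The set \<open>A'\<close> carries on each column a translated copy of what \<open>A\<close>
  carries on the representative.\<close>

theorem column_replacement:
  fixes e :: "Z2 \<Rightarrow> real"
  assumes fin: "finite F" and w0: "w \<noteq> 0"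
    and perA: "has_period (L \<odot> w) (indicator A :: Z2 \<Rightarrow> real)"
    and tile: "\<And>x. (\<Sum>f\<in>F. indicator A (x - f)) = e x"
    and pere: "\<And>z. has_period (N \<odot> z) e"
    and Y: "N dvd Y" "fact (card F) dvd Y" "L * coord w dvd Y" "Y > 0"
    and P: "P \<noteq> 0" "Y dvd P"
      "\<And>f f'. f \<in> F \<Longrightarrow> f' \<in> F \<Longrightarrow> det2 w (f - f') \<noteq> 0 \<Longrightarrow> Y * det2 w (f - f') dvd P"
  obtains A' where "\<And>z. has_period (P \<odot> z) (indicator A' :: Z2 \<Rightarrow> real)"
    "\<And>x. (\<Sum>f\<in>F. indicator A' (x - f)) = e x"
proof -
  define R where "R c = {c + P * det2 w z | z. True}" for c
  define \<rho> where "\<rho> c = (SOME c'. c' \<in> R c)" for c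
  have R_self: "c \<in> R c" for c
  proof -
    have "c = c + P * det2 w 0" by (simp add: det2_def)
    then show ?thesis unfolding R_def by blast
  qed
  have "\<rho> c \<in> R c" for c unfolding \<rho>_def by (rule someI[where P = "\<lambda>c'. c' \<in> R c", OF R_self])
  then have "\<exists>z. \<rho> c = c + P * det2 w z" for c by (simp add: R_def)
  then obtain s where s: "\<And>c. \<rho> c = c + P * det2 w (s c)" by metis
  \<comment> \<open>Equivalent columns have equal classes, hence the same representative.\<close>
  have R_shift: "R (c + P * det2 w z) = R c" for c z
  proof -
    have "c + P * det2 w z + P * det2 w z' = c + P * det2 w (z + z')"
      and "c + P * det2 w z' = c + P * det2 w z + P * det2 w (z' - z)" for z'
      by (simp_all add: det2_add_right det2_diff_right algebra_simps)
    then show ?thesis unfolding R_def by (intro equalityI subsetI; unfold mem_Collect_eq; metis)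
  qed
  define A' where "A' = {x. x + P \<odot> s (det2 w x) \<in> A}"
  have perA': "has_period (P \<odot> z) (indicator A' :: Z2 \<Rightarrow> real)" for z
  proof (rule per_indicatorI)
    fix m x assume x: "x \<in> A'"
    define y where "y = m \<odot> z"
    define x' where "x' = x + P \<odot> y"
    define d where "d = y + s (det2 w x') - s (det2 w x)"
    have det': "det2 w x' = det2 w x + P * det2 w y" by (simp add: x'_def det2_add_right)
    then have "\<rho> (det2 w x') = \<rho> (det2 w x)" by (simp add: \<rho>_def R_shift)
    \<comment> \<open>Both points are moved to the same column, so the two shifts differ by a vector parallel to \<open>w\<close>.\<close>
    then have "P * det2 w d = 0"
      using s[of "det2 w x"] s[of "det2 w x'"] det'
      by (simp add: d_def det2_add_right det2_diff_right algebra_simps)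
    then have "det2 w d = 0" using P(1) by simp
    then have "has_period (P \<odot> d) (indicator A :: Z2 \<Rightarrow> real)"
      by (rule per_parallel[OF perA _ w0 dvd_trans[OF Y(3) P(2)]])
    moreover have "x' + P \<odot> s (det2 w x') = x + P \<odot> s (det2 w x) + P \<odot> d"
      by (simp add: x'_def d_def smult_add_right smult_diff_right)
    moreover have "x + P \<odot> s (det2 w x) \<in> A" using x by (simp add: A'_def)
    ultimately have "x' + P \<odot> s (det2 w x') \<in> A" by (simp only: per_indicatorD)
    then have "x' \<in> A'" by (simp add: A'_def)
    then show "x + m \<odot> P \<odot> z \<in> A'" by (simp add: x'_def y_def ac_simps)
  qed
  have part: "(\<Sum>f | f \<in> F \<and> det2 w (f - f0) = 0. indicator A' (x - (f - f0)))
      = (\<Sum>f | f \<in> F \<and> det2 w (f - f0) = 0. indicator A (x - (f - f0)) :: real)" if "f0 \<in> F" for f0 x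
  proof -
    define h where "h = P \<odot> s (det2 w x)"
    have "indicator A' (x - (f - f0)) = (indicator A (x + h - (f - f0)) :: real)"
      if "det2 w (f - f0) = 0" for f
    proof -
      have "det2 w (x - (f - f0)) = det2 w x" by (simp add: det2_diff_right[of w x] that)
      moreover have "x - (f - f0) + h = x + h - (f - f0)" by simp
      ultimately have "x - (f - f0) \<in> A' \<longleftrightarrow> x + h - (f - f0) \<in> A"
        by (simp only: A'_def mem_Collect_eq h_def)
      then show ?thesis by (simp add: indicator_def)
    qed
    then have "(\<Sum>f | f \<in> F \<and> det2 w (f - f0) = 0. indicator A' (x - (f - f0)))
      = (\<Sum>f | f \<in> F \<and> det2 w (f - f0) = 0. indicator A (x + h - (f - f0)) :: real)"
      by (intro sum.cong refl) simp
    also have "\<dots> = (\<Sum>f | f \<in> F \<and> det2 w (f - f0) = 0. indicator A (x - (f - f0)))"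
      unfolding h_def
      by (rule perD[OF parallel_part_periodic[OF fin that w0 perA tile pere Y P(2) P(3)]]) (use that in auto)
    finally show ?thesis .
  qed
  have "(\<Sum>f\<in>F. indicator A' (x - f)) = e x" for x
  proof -
    have "(\<Sum>f | f \<in> F \<and> det2 w f = c. indicator A' (x - f))
        = (\<Sum>f | f \<in> F \<and> det2 w f = c. indicator A (x - f) :: real)" if "c \<in> det2 w ` F" for c
    proof -
      obtain f0 where f0: "f0 \<in> F" "c = det2 w f0" using \<open>c \<in> det2 w ` F\<close> by blast
      have "x - f0 - (f - f0) = x - f" for f by simp
      then show ?thesis using part[OF f0(1), of "x - f0"] by (simp add: f0(2) det2_diff_right)
    qed
    then have "(\<Sum>f\<in>F. indicator A' (x - f)) = (\<Sum>f\<in>F. indicator A (x - f) :: real)"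
      using sum.image_gen[OF fin, of "\<lambda>f. indicator A' (x - f) :: real" "det2 w"]
        sum.image_gen[OF fin, of "\<lambda>f. indicator A (x - f) :: real" "det2 w"] by simp
    then show ?thesis using tile by simp
  qed
  with perA' show ?thesis by (rule that)
qed

section \<open>The quantitative periodic tiling theorem\<close>

text \<open>Replacing a vanishing determinant by 1 allows products over all pairs.\<close>

definition nz :: "int \<Rightarrow> int" where
  "nz k = (if k = 0 then 1 else \<bar>k\<bar>)"

lemma nz_pos: "nz k > 0"
  by (simp add: nz_def)

lemma dvd_nz: "k \<noteq> 0 \<Longrightarrow> k dvd nz k"
  by (simp add: nz_def)

lemma tiling_iff:
  assumes "finite F"
  shows "tiling F A E \<longleftrightarrow> (\<forall>x. (\<Sum>f\<in>F. indicator A (x - f)) = (indicator E x :: real))"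
proof -
  have "conv (indicator F) (indicator A) x = (\<Sum>f\<in>F. indicator A (x - f))" for x
  proof -
    have "conv (indicator F) (indicator A) x = infsum (\<lambda>f. indicator A (x - f)) F"
      unfolding conv_def by (rule infsum_cong_neutral) auto
    then show ?thesis using assms by simp
  qed
  then show ?thesis by (simp add: tiling_def fun_eq_iff)
qed

lemma periodic_iff: "periodic (scaled_lattice l) S \<longleftrightarrow> (\<forall>z. has_period (l \<odot> z) (indicator S :: Z2 \<Rightarrow> real))"
proof -
  have "scaled_lattice l = range (\<lambda>z. l \<odot> z)"
    unfolding scaled_lattice_def image_def smult_def by (simp add: split_paired_Ex)
  then show ?thesis by (auto simp: periodic_def has_period_def)
qed

lemma indicator_of_sum:
  fixes B :: "'i \<Rightarrow> Z2 set"
  assumes "finite W" and "(\<Sum>w\<in>W. indicator (B w) x :: real) \<le> 1"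
  shows "(\<Sum>w\<in>W. indicator (B w) x :: real) = indicator (\<Union>w\<in>W. B w) x"
proof (cases "\<exists>w\<in>W. x \<in> B w")
  case True
  then obtain w where w: "w \<in> W" "x \<in> B w" by blast
  have "(indicator (B w) x :: real) \<le> (\<Sum>w\<in>W. indicator (B w) x)"
    by (rule member_le_sum[where f = "\<lambda>w. indicator (B w) x :: real"]) (use w assms(1) in auto)
  then show ?thesis using assms(2) w by (auto simp: indicator_def split: if_splits)
next
  case False
  then show ?thesis by (simp add: indicator_def)
qed

text \<open>Multiplying \<open>f - f0\<close> by the coordinates of all other differences yields the same vector \<open>W f\<close> for parallel
  differences, namely the full product of coordinates times \<open>(f - f0) / coord (f - f0)\<close>. So \<open>U = W ` G\<close> has
  one vector per direction, and its vectors are integral multiples of all the differences of this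
  direction.\<close>

lemma weak_periodicity_of_tiling:
  assumes fin: "finite F" and f0: "f0 \<in> F" and l: "l > 0"
    and tile: "\<And>x. (\<Sum>f\<in>F. indicator A (x - f)) = (indicator E x :: real)"
    and perE: "\<And>z. has_period (l \<odot> z) (indicator E :: Z2 \<Rightarrow> real)"
    and C: "\<And>P. poly_mod \<int> (card F) P \<Longrightarrow> (\<forall>t. 0 \<le> P t \<and> P t \<le> 1 / 2) \<Longrightarrow> period_mod1 C P"
  obtains U B \<Delta> where "finite U" "0 \<notin> U" "card U \<le> card F"
    "\<And>w. w \<in> U \<Longrightarrow> \<exists>f\<in>F - {f0}. w = (\<Prod>g\<in>F - {f0} - {f}. coord (g - f0)) \<odot> (f - f0)"
    "\<And>w w'. w \<in> U \<Longrightarrow> w' \<in> U \<Longrightarrow> w \<noteq> w' \<Longrightarrow> det2 w w' dvd \<Delta>"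
    "\<Delta> = (\<Prod>w\<in>U. \<Prod>w'\<in>U. nz (det2 w w'))"
    "\<And>w. w \<in> U \<Longrightarrow> has_period ((l * fact (card F)) \<odot> w) (indicator (B w) :: Z2 \<Rightarrow> real)"
    "\<And>z. has_period ((l * fact (card F) * \<Delta> * int C) \<odot> z) (indicator (B 0) :: Z2 \<Rightarrow> real)"
    "\<And>x. (\<Sum>w\<in>insert 0 U. indicator (B w) x :: real) = indicator A x"
proof -
  define G where "G = F - {f0}"
  have G: "finite G" using fin by (simp add: G_def)
  have vG: "f - f0 \<noteq> 0" if "f \<in> G" for f using that by (simp add: G_def)
  define W where "W f = (\<Prod>g\<in>G - {f}. coord (g - f0)) \<odot> (f - f0)" for f
  define U where "U = W ` G"
  define \<Delta> where "\<Delta> = (\<Prod>w\<in>U. \<Prod>w'\<in>U. nz (det2 w w'))"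
  define L where "L = l * fact (card F)"
  have prod_nz: "(\<Prod>g\<in>G - {f}. coord (g - f0)) \<noteq> 0" for f
    using G vG coord_nonzero by (simp add: prod_zero_iff)
  have finU: "finite U" using G by (simp add: U_def)
  have cardU: "card U \<le> card F"
    unfolding U_def by (rule order_trans[OF card_image_le[OF G] card_mono[OF fin]]) (simp add: G_def)
  have U0: "0 \<notin> U"
  proof
    assume "0 \<in> U"
    then obtain f where f: "f \<in> G" "W f = 0" unfolding U_def by (metis imageE)
    then have "f - f0 = 0" using smult_cancel[OF prod_nz, of f "f - f0" 0] by (simp add: W_def)
    then show False using vG[OF f(1)] by contradiction
  qed
  have Wcoord: "coord (f - f0) \<odot> W f = (\<Prod>g\<in>G. coord (g - f0)) \<odot> (f - f0)" if "f \<in> G" for f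
    using prod.remove[OF G that, of "\<lambda>g. coord (g - f0)"] by (simp add: W_def)
  have parallel: "W f = W f'" if f: "f \<in> G" "f' \<in> G" and "det2 (W f) (W f') = 0" for f f'
  proof -
    let ?v = "f - f0" and ?v' = "f' - f0"
    have "det2 ?v ?v' = 0" using that prod_nz by (simp add: W_def)
    then have par: "coord ?v \<odot> ?v' = coord ?v' \<odot> ?v" using coord_parallel vG f by blast
    have "(coord ?v * coord ?v') \<odot> W f = coord ?v' \<odot> (coord ?v \<odot> W f)" by (simp add: ac_simps)
    also have "\<dots> = (\<Prod>g\<in>G. coord (g - f0)) \<odot> (coord ?v' \<odot> ?v)"
      unfolding Wcoord[OF f(1)] by (simp add: ac_simps)
    also have "\<dots> = coord ?v \<odot> (coord ?v' \<odot> W f')"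
      unfolding Wcoord[OF f(2)] par[symmetric] by (simp add: ac_simps)
    finally have "(coord ?v * coord ?v') \<odot> W f = (coord ?v * coord ?v') \<odot> W f'" by simp
    moreover have "coord ?v * coord ?v' \<noteq> 0" using coord_nonzero vG f by simp
    ultimately show ?thesis using smult_cancel by metis
  qed
  have indep: "det2 w w' dvd \<Delta>" if "w \<in> U" "w' \<in> U" "w \<noteq> w'" for w w'
  proof -
    have "det2 w w' \<noteq> 0" using that parallel by (auto simp: U_def)
    then have "det2 w w' dvd nz (det2 w w')" by (rule dvd_nz)
    also have "\<dots> dvd (\<Prod>w'\<in>U. nz (det2 w w'))" using finU that by (intro dvd_prodI) auto
    also have "\<dots> dvd \<Delta>" unfolding \<Delta>_def
      by (rule dvd_prodI[where f = "\<lambda>w. \<Prod>w'\<in>U. nz (det2 w w')"]) (use finU that in auto)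
    finally show ?thesis .
  qed
  define E' where "E' = {x. x + f0 \<in> E}"
  have E': "indicator E' x = (indicator E (x + f0) :: real)" for x by (simp add: E'_def indicator_def)
  have perE': "has_period (l \<odot> z) (indicator E' :: Z2 \<Rightarrow> real)" for z
    using per_translate[OF perE, of z "- f0"] by (simp add: has_period_def E')
  have tile': "(\<Sum>f\<in>F. indicator A (x - (f - f0))) = (indicator E' x :: real)" for x
    using tile[of "x + f0"] by (simp add: E' algebra_simps)
  have "L > 0" using l by (simp add: L_def)
  then have "(\<Sum>f\<in>F. indicator A (x - (1 + int s * L) \<odot> (f - f0))) = (indicator E' x :: real)" for s x
    by (intro dilation[OF fin tile' perE']) (simp_all add: L_def)
  then obtain \<phi> :: "Z2 \<Rightarrow> Z2 \<Rightarrow> real" where \<phi>: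
    "\<And>f x. f \<in> F \<Longrightarrow> 0 \<le> \<phi> f x"
    "\<And>x. (\<Sum>f\<in>F. \<phi> f x) = indicator E' x"
    "\<And>f. f \<in> F \<Longrightarrow> has_period (L \<odot> (f - f0)) (\<phi> f)"
    "\<And>f x. f \<in> F \<Longrightarrow> has_period (L \<odot> (f - f0)) (indicator A :: Z2 \<Rightarrow> real) \<Longrightarrow> \<phi> f x = indicator A (x - (f - f0))"
    by (rule averaging[OF fin]) blast
  define \<Phi> where "\<Phi> w x = (\<Sum>f | f \<in> G \<and> W f = w. \<phi> f x)" for w x
  obtain B where B: "\<And>w. w \<in> U \<Longrightarrow> has_period (L \<odot> w) (indicator (B w) :: Z2 \<Rightarrow> real)"
    "\<And>z. has_period ((L * \<Delta> * int C) \<odot> z) (indicator (B 0) :: Z2 \<Rightarrow> real)"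
    "\<And>x. (\<Sum>w\<in>insert 0 U. indicator (B w) x :: real) = indicator A x"
  proof (rule weak_periodicity[OF finU U0 indep])
    show "0 \<le> \<Phi> w x" for w x
      unfolding \<Phi>_def by (intro sum_nonneg \<phi>(1)) (auto simp: G_def)
    show "has_period (L \<odot> w) (\<Phi> w)" for w
      unfolding \<Phi>_def
    proof (rule per_sum)
      fix f assume f: "f \<in> {f \<in> G. W f = w}"
      have "has_period ((\<Prod>g\<in>G - {f}. coord (g - f0)) \<odot> (L \<odot> (f - f0))) (\<phi> f)"
        using f by (intro per_smult \<phi>(3)) (simp add: G_def)
      moreover have "(\<Prod>g\<in>G - {f}. coord (g - f0)) \<odot> (L \<odot> (f - f0)) = L \<odot> W f"
        by (simp add: W_def ac_simps)
      ultimately show "has_period (L \<odot> w) (\<phi> f)" using f by simp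
    qed
    show "indicator A x + (\<Sum>w\<in>U. \<Phi> w x) = (indicator E' x :: real)" for x
    proof -
      have "(\<Sum>w\<in>U. \<Phi> w x) = (\<Sum>f\<in>G. \<phi> f x)"
        using sum.image_gen[OF G, of "\<lambda>f. \<phi> f x" W] by (simp add: U_def \<Phi>_def)
      moreover have "\<phi> f0 x = indicator A x" using \<phi>(4)[OF f0, of x] by (simp add: has_period_def)
      moreover have "(\<Sum>f\<in>F. \<phi> f x) = \<phi> f0 x + (\<Sum>f\<in>G. \<phi> f x)"
        unfolding G_def using fin f0 by (rule sum.remove)
      ultimately show ?thesis using \<phi>(2)[of x] by simp
    qed
    show "has_period (L \<odot> z) (indicator E' :: Z2 \<Rightarrow> real)" for z
      using perE'[of "fact (card F) \<odot> z"] by (simp add: L_def)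
    show "period_mod1 C P" if "poly_mod \<int> (card U) P" "\<forall>t. 0 \<le> P t \<and> P t \<le> 1 / 2" for P
      by (rule C[OF poly_mod_Ints_le[OF cardU that(1)] that(2)])
  qed auto
  show ?thesis
  proof (rule that[OF finU U0 cardU])
    show "\<exists>f\<in>F - {f0}. w = (\<Prod>g\<in>F - {f0} - {f}. coord (g - f0)) \<odot> (f - f0)" if "w \<in> U" for w
      using that unfolding U_def W_def G_def by blast
  qed (use indep \<Delta>_def B in \<open>auto simp: L_def\<close>)
qed

text \<open>The period of the new tiling, relative to \<open>l\<close>. The first three factors, times \<open>l\<close>, give the double period
  \<open>N\<close> of the convolutions of the pieces with \<open>F\<close>. The next two allow a second dilation, and the last one
  provides the determinants in \<open>parallel_part_periodic\<close>, for all pieces and all base points at once.\<close>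

definition total_period :: "int \<Rightarrow> nat \<Rightarrow> Z2 set \<Rightarrow> Z2 set \<Rightarrow> int" where
  "total_period C n F U = fact n * (\<Prod>w\<in>U. \<Prod>w'\<in>U. nz (det2 w w')) * C * fact n
     * (\<Prod>w\<in>U. \<bar>coord w\<bar>) * (\<Prod>w\<in>U. \<Prod>f\<in>F. \<Prod>f'\<in>F. nz (det2 w (f - f')))"

text \<open>The columns of each singly periodic piece are replaced separately. As the convolutions with \<open>F\<close> do not
  change, their sum is still the indicator of \<open>E\<close>, which forces the new pieces to be disjoint.\<close>

theorem periodic_tiling:
  assumes fin: "finite F" and f0: "f0 \<in> F" and l: "l > 0"
    and tile: "\<And>x. (\<Sum>f\<in>F. indicator A (x - f)) = (indicator E x :: real)"
    and perE: "\<And>z. has_period (l \<odot> z) (indicator E :: Z2 \<Rightarrow> real)"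
    and C: "\<And>P. poly_mod \<int> (card F) P \<Longrightarrow> (\<forall>t. 0 \<le> P t \<and> P t \<le> 1 / 2) \<Longrightarrow> period_mod1 C P"
    and Cpos: "C > 0"
  obtains U A' where "finite U" "0 \<notin> U" "card U \<le> card F"
    "\<And>w. w \<in> U \<Longrightarrow> \<exists>f\<in>F - {f0}. w = (\<Prod>g\<in>F - {f0} - {f}. coord (g - f0)) \<odot> (f - f0)"
    "\<And>x. (\<Sum>f\<in>F. indicator A' (x - f)) = (indicator E x :: real)"
    "\<And>z. has_period ((l * total_period C (card F) F U) \<odot> z) (indicator A' :: Z2 \<Rightarrow> real)"
proof -
  obtain U B \<Delta> where U: "finite U" "0 \<notin> U" "card U \<le> card F"
    "\<And>w. w \<in> U \<Longrightarrow> \<exists>f\<in>F - {f0}. w = (\<Prod>g\<in>F - {f0} - {f}. coord (g - f0)) \<odot> (f - f0)"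
    "\<And>w w'. w \<in> U \<Longrightarrow> w' \<in> U \<Longrightarrow> w \<noteq> w' \<Longrightarrow> det2 w w' dvd \<Delta>"
    and \<Delta>: "\<Delta> = (\<Prod>w\<in>U. \<Prod>w'\<in>U. nz (det2 w w'))"
    and B: "\<And>w. w \<in> U \<Longrightarrow> has_period ((l * fact (card F)) \<odot> w) (indicator (B w) :: Z2 \<Rightarrow> real)"
    "\<And>z. has_period ((l * fact (card F) * \<Delta> * int C) \<odot> z) (indicator (B 0) :: Z2 \<Rightarrow> real)"
    "\<And>x. (\<Sum>w\<in>insert 0 U. indicator (B w) x :: real) = indicator A x"
    by (rule weak_periodicity_of_tiling[OF fin f0 l tile perE C]) blast+
  define L where "L = l * fact (card F)"
  define N where "N = L * \<Delta> * int C"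
  define Y where "Y = N * fact (card F) * (\<Prod>w\<in>U. \<bar>coord w\<bar>)"
  define P where "P = Y * (\<Prod>w\<in>U. \<Prod>f\<in>F. \<Prod>f'\<in>F. nz (det2 w (f - f')))"
  have P_eq: "P = l * total_period C (card F) F U"
    by (simp add: P_def Y_def N_def L_def \<Delta> total_period_def ac_simps)
  have \<Delta>pos: "\<Delta> > 0" unfolding \<Delta> by (intro prod_pos) (simp add: nz_pos)
  then have Npos: "N > 0" using l Cpos by (simp add: N_def L_def)
  have "(\<Prod>w\<in>U. \<bar>coord w\<bar>) > 0" using U(2) coord_nonzero by (intro prod_pos) (metis zero_less_abs_iff)
  then have Ypos: "Y > 0" using Npos by (simp add: Y_def)
  have "(\<Prod>w\<in>U. \<Prod>f\<in>F. \<Prod>f'\<in>F. nz (det2 w (f - f'))) > 0" by (intro prod_pos) (simp add: nz_pos)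
  then have Ppos: "P > 0" using Ypos by (simp add: P_def)
  define e where "e w x = (\<Sum>f\<in>F. indicator (B w) (x - f) :: real)" for w x
  have e_total: "(\<Sum>w\<in>insert 0 U. e w x) = indicator E x" for x
    unfolding e_def by (subst sum.swap) (simp only: B(3) tile)
  have e_per: "has_period h (e w)" if "has_period h (indicator (B w) :: Z2 \<Rightarrow> real)" for h w
    unfolding e_def[abs_def] by (intro per_sum per_translate that)
  have ld: "l dvd N" by (simp add: N_def L_def)
  have e_doubly: "has_period (N \<odot> z) (e w)" if "w \<in> U" for w z
    unfolding N_def
  proof (rule pieces_doubly_periodic[OF U(1,2,5)])
    show "has_period (L \<odot> w) (e w)" if "w \<in> U" for w using e_per B(1) that by (simp add: L_def)
    show "has_period ((L * \<Delta> * int C) \<odot> z) (e 0)" for z using e_per B(2) by (simp add: L_def)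
    show "has_period ((L * \<Delta> * int C) \<odot> z) (\<lambda>x. \<Sum>w\<in>insert 0 U. e w x)" for z
      unfolding e_total using per_dvd[OF perE ld] by (simp add: N_def)
    show "\<bar>e w x\<bar> \<le> card F" for w x
    proof -
      have "\<bar>e w x\<bar> \<le> (\<Sum>f\<in>F. 1)" unfolding e_def
        by (rule order_trans[OF sum_abs sum_mono]) simp
      then show ?thesis by simp
    qed
  qed (use that in auto)
  have "\<exists>A'. (\<forall>z. has_period (P \<odot> z) (indicator A' :: Z2 \<Rightarrow> real)) \<and> (\<forall>x. (\<Sum>f\<in>F. indicator A' (x - f)) = e w x)"
    if w: "w \<in> insert 0 U" for w
  proof (cases "w = 0")
    case True
    have "N dvd P" by (simp add: P_def Y_def)
    then have "has_period (P \<odot> z) (indicator (B 0) :: Z2 \<Rightarrow> real)" for z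
      using per_dvd B(2) by (metis N_def L_def)
    then show ?thesis using True by (intro exI[of _ "B 0"]) (simp add: e_def)
  next
    case False
    then have w: "w \<in> U" using w by blast
    have "coord w dvd (\<Prod>w\<in>U. \<bar>coord w\<bar>)"
      by (rule dvd_trans[OF _ dvd_prodI[OF U(1) w]]) simp
    moreover have "L dvd N * fact (card F)" by (simp add: N_def)
    ultimately have LY: "L * coord w dvd Y" unfolding Y_def by (rule mult_dvd_mono[rotated])
    have YP: "Y * det2 w (f - f') dvd P" if f: "f \<in> F" "f' \<in> F" "det2 w (f - f') \<noteq> 0" for f f'
    proof -
      have "det2 w (f - f') dvd nz (det2 w (f - f'))" using f(3) by (rule dvd_nz)
      also have "\<dots> dvd (\<Prod>f'\<in>F. nz (det2 w (f - f')))"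
        by (rule dvd_prodI[where f = "\<lambda>f'. nz (det2 w (f - f'))", OF fin f(2)])
      also have "\<dots> dvd (\<Prod>f\<in>F. \<Prod>f'\<in>F. nz (det2 w (f - f')))"
        by (rule dvd_prodI[where f = "\<lambda>f. \<Prod>f'\<in>F. nz (det2 w (f - f'))", OF fin f(1)])
      also have "\<dots> dvd (\<Prod>w\<in>U. \<Prod>f\<in>F. \<Prod>f'\<in>F. nz (det2 w (f - f')))"
        by (rule dvd_prodI[where f = "\<lambda>w. \<Prod>f\<in>F. \<Prod>f'\<in>F. nz (det2 w (f - f'))", OF U(1) w])
      finally show ?thesis unfolding P_def by (rule mult_dvd_mono[OF dvd_refl])
    qed
    obtain A' where "\<And>z. has_period (P \<odot> z) (indicator A' :: Z2 \<Rightarrow> real)"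
      "\<And>x. (\<Sum>f\<in>F. indicator A' (x - f)) = e w x"
    proof (rule column_replacement[OF fin False])
      show "has_period (L \<odot> w) (indicator (B w) :: Z2 \<Rightarrow> real)" using B(1)[OF w] by (simp add: L_def)
      show "(\<Sum>f\<in>F. indicator (B w) (x - f)) = e w x" for x by (simp add: e_def)
      show "has_period (N \<odot> z) (e w)" for z by (rule e_doubly[OF w])
      show "N dvd Y" "fact (card F) dvd Y" by (simp_all add: Y_def)
      show "L * coord w dvd Y" by (rule LY)
      show "Y > 0" "P \<noteq> 0" using Ypos Ppos by simp_all
      show "Y dvd P" by (simp add: P_def)
    qed (use YP in auto)
    then show ?thesis by blast
  qed
  then obtain B' where B': "\<And>w z. w \<in> insert 0 U \<Longrightarrow> has_period (P \<odot> z) (indicator (B' w) :: Z2 \<Rightarrow> real)"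
    "\<And>w x. w \<in> insert 0 U \<Longrightarrow> (\<Sum>f\<in>F. indicator (B' w) (x - f)) = e w x"
    by metis
  define A' where "A' = (\<Union>w\<in>insert 0 U. B' w)"
  have sum_B': "(\<Sum>f\<in>F. \<Sum>w\<in>insert 0 U. indicator (B' w) (x - f)) = (indicator E x :: real)" for x
    by (subst sum.swap) (simp only: B'(2) e_total cong: sum.cong)
  have ind: "(\<Sum>w\<in>insert 0 U. indicator (B' w) x :: real) = indicator A' x" for x
    unfolding A'_def
  proof (rule indicator_of_sum)
    \<comment> \<open>At \<open>x + f0\<close>, the contribution of \<open>f0\<close> alone is the sum in question.\<close>
    define b where "b f = (\<Sum>w\<in>insert 0 U. indicator (B' w) (x + f0 - f) :: real)" for f
    have "b f0 \<le> (\<Sum>f\<in>F. b f)"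
      by (rule member_le_sum[OF f0 _ fin]) (simp only: b_def sum_nonneg indicator_pos_le)
    also have "\<dots> \<le> 1" unfolding b_def sum_B' by (simp add: indicator_def)
    finally show "(\<Sum>w\<in>insert 0 U. indicator (B' w) x :: real) \<le> 1" by (simp only: b_def add_diff_cancel_right')
  qed (use U(1) in simp)
  show ?thesis
  proof (rule that[OF U(1-4)])
    show "(\<Sum>f\<in>F. indicator A' (x - f)) = (indicator E x :: real)" for x
      using sum_B'[of x] by (simp only: ind)
    show "has_period ((l * total_period C (card F) F U) \<odot> z) (indicator A' :: Z2 \<Rightarrow> real)" for z
    proof -
      have "has_period (P \<odot> z) (\<lambda>x. \<Sum>w\<in>insert 0 U. indicator (B' w) x :: real)"
        by (rule per_sum) (rule B'(1))
      then show ?thesis by (simp only: ind P_eq)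
    qed
  qed
qed

lemma abs_coord_le:
  assumes "\<bar>real_of_int (fst v)\<bar> \<le> D" "\<bar>real_of_int (snd v)\<bar> \<le> D"
  shows "real_of_int \<bar>coord v\<bar> \<le> D"
  using assms by (simp add: coord_def)

lemma nz_det2_le:
  assumes "\<bar>real_of_int (fst v)\<bar> \<le> a" "\<bar>real_of_int (snd v)\<bar> \<le> a"
    and "\<bar>real_of_int (fst w)\<bar> \<le> b" "\<bar>real_of_int (snd w)\<bar> \<le> b"
    and "1 \<le> a * b"
  shows "real_of_int (nz (det2 v w)) \<le> 2 * (a * b)"
proof -
  have "\<bar>real_of_int (fst v) * real_of_int (snd w)\<bar> \<le> a * b"
    unfolding abs_mult by (rule mult_mono) (use assms in linarith)+
  moreover have "\<bar>real_of_int (snd v) * real_of_int (fst w)\<bar> \<le> a * b"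
    unfolding abs_mult by (rule mult_mono) (use assms in linarith)+
  ultimately have "\<bar>real_of_int (fst v) * real_of_int (snd w)
      - real_of_int (snd v) * real_of_int (fst w)\<bar> \<le> 2 * (a * b)"
    by linarith
  then show ?thesis using assms(5) by (simp add: nz_def det2_def)
qed

text \<open>With \<open>K = 2 D\<^sup>2\<^sup>n\<close> as a bound for all determinants, there are at most \<open>n\<^sup>2\<close> of them in \<open>\<Delta>\<close> and \<open>n\<^sup>3\<close> in the
  last factor of the period.\<close>

lemma total_period_le:
  fixes D :: real
  assumes fin: "finite F" and U: "finite U" "card U \<le> card F" and n: "card F = n"
    and D: "1 \<le> D"
    and diff: "\<And>f f'. f \<in> F \<Longrightarrow> f' \<in> F \<Longrightarrow>
      \<bar>real_of_int (fst (f - f'))\<bar> \<le> D \<and> \<bar>real_of_int (snd (f - f'))\<bar> \<le> D"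
    and f0: "f0 \<in> F"
    and form: "\<And>w. w \<in> U \<Longrightarrow> \<exists>f\<in>F - {f0}. w = (\<Prod>g\<in>F - {f0} - {f}. coord (g - f0)) \<odot> (f - f0)"
    and C: "C > 0"
  shows "real_of_int (total_period C n F U)
    \<le> ((fact n)\<^sup>2 * real_of_int C * 2 ^ (n ^ 2 + n ^ 3)) * D ^ (5 * n ^ 4)"
proof -
  have npos: "n > 0" using f0 fin n by (metis card_gt_0_iff empty_iff)
  have Dp: "1 \<le> D ^ k" for k using D by (rule one_le_power)
  have w_le: "\<bar>real_of_int (fst w)\<bar> \<le> D ^ n" "\<bar>real_of_int (snd w)\<bar> \<le> D ^ n" if wU: "w \<in> U" for w
  proof -
    obtain f where f: "f \<in> F - {f0}" "w = (\<Prod>g\<in>F - {f0} - {f}. coord (g - f0)) \<odot> (f - f0)"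
      using form[OF wU] by blast
    have c: "real_of_int \<bar>coord (g - f0)\<bar> \<le> D" if "g \<in> F" for g
      using abs_coord_le[of "g - f0" D] diff[OF that f0] by blast
    have "real_of_int (\<Prod>g\<in>F - {f0} - {f}. \<bar>coord (g - f0)\<bar>) = (\<Prod>g\<in>F - {f0} - {f}. real_of_int \<bar>coord (g - f0)\<bar>)"
      by simp
    also have "\<dots> \<le> D ^ (n - 1)"
    proof (rule prod_le_power)
      have "card (F - {f0} - {f}) \<le> card (F - {f0})" using fin by (intro card_mono) auto
      then show "card (F - {f0} - {f}) \<le> n - 1" using f0 fin n by simp
    qed (use c D in auto)
    finally have p: "real_of_int \<bar>\<Prod>g\<in>F - {f0} - {f}. coord (g - f0)\<bar> \<le> D ^ (n - 1)"
      by (simp add: abs_prod)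
    define p where "p = (\<Prod>g\<in>F - {f0} - {f}. coord (g - f0))"
    have scale: "\<bar>real_of_int (p * k)\<bar> \<le> D ^ n" if "\<bar>real_of_int k\<bar> \<le> D" for k
    proof -
      have "\<bar>real_of_int (p * k)\<bar> = real_of_int \<bar>p\<bar> * \<bar>real_of_int k\<bar>" by (simp add: abs_mult)
      also have "\<dots> \<le> D ^ (n - 1) * D"
        by (rule mult_mono) (use p that D in \<open>simp_all add: p_def\<close>)
      also have "\<dots> = D ^ n" using npos by (rule power_minus_mult)
      finally show ?thesis .
    qed
    have d: "\<bar>real_of_int (fst (f - f0))\<bar> \<le> D" "\<bar>real_of_int (snd (f - f0))\<bar> \<le> D"
      using diff[of f f0] f(1) f0 by blast+
    have "fst w = p * fst (f - f0)" "snd w = p * snd (f - f0)"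
      unfolding f(2) p_def by (simp_all only: fst_smult snd_smult)
    then show "\<bar>real_of_int (fst w)\<bar> \<le> D ^ n" "\<bar>real_of_int (snd w)\<bar> \<le> D ^ n"
      using scale[OF d(1)] scale[OF d(2)] by (simp_all only:)
  qed
  define K where "K = 2 * D ^ (2 * n)"
  have K1: "1 \<le> K" using Dp[of "2 * n"] by (simp add: K_def)
  have det_UU: "real_of_int (nz (det2 w w')) \<le> K" if "w \<in> U" "w' \<in> U" for w w'
    using nz_det2_le[OF w_le[OF that(1)] w_le[OF that(2)]] Dp[of "n + n"]
    by (simp only: K_def mult_2[of n] power_add)
  have det_UF: "real_of_int (nz (det2 w (f - f'))) \<le> K" if "w \<in> U" "f \<in> F" "f' \<in> F" for w f f'
  proof -
    have "1 \<le> D ^ n * D" using Dp[of "Suc n"] by (simp add: mult.commute)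
    then have "real_of_int (nz (det2 w (f - f'))) \<le> 2 * (D ^ n * D)"
      using nz_det2_le[OF w_le[OF that(1)], of "f - f'" D] diff[OF that(2,3)] by blast
    also have "\<dots> \<le> K"
      unfolding K_def using D npos power_increasing[of "Suc n" "2 * n" D] by (simp add: mult.commute)
    finally show ?thesis .
  qed
  have nz0: "0 \<le> real_of_int (nz k)" for k using nz_pos[of k] by simp
  have cU: "card U \<le> n" using U n by simp
  have p1: "(\<Prod>w\<in>U. \<Prod>w'\<in>U. real_of_int (nz (det2 w w'))) \<le> (K ^ n) ^ n"
    by (intro prod_le_power conjI prod_nonneg ballI nz0 cU one_le_power K1 det_UU)
  have p2: "(\<Prod>w\<in>U. real_of_int \<bar>coord w\<bar>) \<le> (D ^ n) ^ n"
    by (intro prod_le_power conjI cU Dp abs_coord_le w_le) auto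
  have p3: "(\<Prod>w\<in>U. \<Prod>f\<in>F. \<Prod>f'\<in>F. real_of_int (nz (det2 w (f - f')))) \<le> ((K ^ n) ^ n) ^ n"
    by (intro prod_le_power conjI prod_nonneg ballI nz0 cU one_le_power K1 det_UF) (simp_all add: n)
  have "real_of_int (total_period C n F U) = ((fact n)\<^sup>2 * real_of_int C)
      * ((\<Prod>w\<in>U. \<Prod>w'\<in>U. real_of_int (nz (det2 w w'))) * (\<Prod>w\<in>U. real_of_int \<bar>coord w\<bar>)
        * (\<Prod>w\<in>U. \<Prod>f\<in>F. \<Prod>f'\<in>F. real_of_int (nz (det2 w (f - f')))))"
    by (simp add: total_period_def power2_eq_square ac_simps)
  also have "\<dots> \<le> ((fact n)\<^sup>2 * real_of_int C) * ((K ^ n) ^ n * (D ^ n) ^ n * ((K ^ n) ^ n) ^ n)"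
    using C D K1
    by (intro mult_left_mono mult_mono p1 p2 p3 mult_nonneg_nonneg prod_nonneg ballI nz0) auto
  also have "(K ^ n) ^ n * (D ^ n) ^ n * ((K ^ n) ^ n) ^ n
      = 2 ^ (n ^ 2 + n ^ 3) * D ^ (2 * n ^ 3 + n ^ 2 + 2 * n ^ 4)"
  proof -
    have K: "K ^ m = 2 ^ m * D ^ (2 * n * m)" for m
      by (simp only: K_def power_mult_distrib power_mult[symmetric])
    have "(K ^ n) ^ n * (D ^ n) ^ n * ((K ^ n) ^ n) ^ n
        = (2 ^ (n * n) * 2 ^ (n * n * n)) * (D ^ (2 * n * (n * n)) * D ^ (n * n) * D ^ (2 * n * (n * n * n)))"
      by (simp only: K power_mult[symmetric] power_mult_distrib mult_ac)
    also have "\<dots> = 2 ^ (n * n + n * n * n) * D ^ (2 * n * (n * n) + n * n + 2 * n * (n * n * n))"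
      by (simp only: power_add)
    finally show ?thesis by (simp only: power2_eq_square power3_eq_cube power4_eq_xxxx mult.assoc)
  qed
  also have "((fact n)\<^sup>2 * real_of_int C) * \<dots>
      \<le> ((fact n)\<^sup>2 * real_of_int C) * (2 ^ (n ^ 2 + n ^ 3) * D ^ (5 * n ^ 4))"
  proof (intro mult_left_mono power_increasing D)
    have "n ^ 3 \<le> n ^ 4" "n ^ 2 \<le> n ^ 4" using npos by (auto intro: power_increasing)
    then show "2 * n ^ 3 + n ^ 2 + 2 * n ^ 4 \<le> 5 * n ^ 4" by simp
  qed (use C in auto)
  finally show ?thesis by (simp add: ac_simps)
qed

lemma diff_le_diam:
  assumes fin: "finite F" and f: "f \<in> F" "f' \<in> F"
  shows "\<bar>real_of_int (fst (f - f'))\<bar> \<le> diam F" "\<bar>real_of_int (snd (f - f'))\<bar> \<le> diam F"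
proof -
  define r where "r = (\<lambda>(a, b). (real_of_int a, real_of_int b))"
  have "dist (r f) (r f') \<le> diam F"
    unfolding diam_def r_def
    by (rule diameter_bounded_bound) (use assms in \<open>auto simp: finite_imp_bounded\<close>)
  moreover have "fst (r f) = fst f" "snd (r f) = snd f" "fst (r f') = fst f'" "snd (r f') = snd f'"
    by (simp_all add: r_def split: prod.splits)
  ultimately show "\<bar>real_of_int (fst (f - f'))\<bar> \<le> diam F" "\<bar>real_of_int (snd (f - f'))\<bar> \<le> diam F"
    using dist_fst_le[of "r f" "r f'"] dist_snd_le[of "r f" "r f'"] by (simp_all add: dist_real_def)
qed

lemma diam_ge_1:
  assumes fin: "finite F" and card: "card F \<ge> 2"
  shows "1 \<le> diam F"
proof -
  obtain f f' where f: "f \<in> F" "f' \<in> F" "f \<noteq> f'"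
    using card by (metis card_le_Suc0_iff_eq fin not_less_eq_eq numeral_2_eq_2)
  then have "fst (f - f') \<noteq> 0 \<or> snd (f - f') \<noteq> 0" by (auto simp: prod_eq_iff)
  then have "1 \<le> \<bar>fst (f - f')\<bar> \<or> 1 \<le> \<bar>snd (f - f')\<bar>" by linarith
  then have "1 \<le> \<bar>real_of_int (fst (f - f'))\<bar> \<or> 1 \<le> \<bar>real_of_int (snd (f - f'))\<bar>" by linarith
  then show ?thesis using diff_le_diam[OF fin f(1,2)] by linarith
qed

lemma tiling_small:
  assumes fin: "finite F" and "card F \<le> 1"
    and tile: "\<And>x. (\<Sum>f\<in>F. indicator A (x - f)) = (indicator E x :: real)"
    and perE: "\<And>z. has_period (l \<odot> z) (indicator E :: Z2 \<Rightarrow> real)"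
  obtains A' where "\<And>z. has_period (l \<odot> z) (indicator A' :: Z2 \<Rightarrow> real)"
    "\<And>x. (\<Sum>f\<in>F. indicator A' (x - f)) = (indicator E x :: real)"
proof (cases "F = {}")
  case True
  show ?thesis by (rule that[of "{}"]) (use True tile in \<open>auto simp: has_period_def\<close>)
next
  case False
  then obtain f where F: "F = {f}"
    using assms(1,2) by (metis card_1_singletonE card_0_eq le_Suc_eq One_nat_def le_zero_eq)
  have A: "indicator A x = (indicator E (x + f) :: real)" for x using tile[of "x + f"] by (simp add: F)
  have "has_period (l \<odot> z) (indicator A :: Z2 \<Rightarrow> real)" for z
    using per_translate[OF perE, of z "- f"] by (simp add: has_period_def A)
  then show ?thesis using tile that by blast
qed

theorem theorem1p5:
  "\<exists>(c::real) (C :: nat \<Rightarrow> real). c > 0 \<and> (\<forall>n. C n > 0) \<and>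
     (\<forall>(F :: Z2 set) (E :: Z2 set) (l::int).
        finite F \<longrightarrow> l \<ge> 1 \<longrightarrow> periodic (scaled_lattice l) E \<longrightarrow> (\<exists>A. tiling F A E) \<longrightarrow>
        (\<exists>(M::int) A'. M > 0 \<and> tiling F A' E \<and> periodic (scaled_lattice (l * M)) A' \<and>
           real_of_int M \<le>
             (if card F \<le> 1 then C (card F)
              else C (card F) * diam F powr (c * real (card F) ^ 4))))"
proof -
  obtain Q where Q: "\<And>n. Q n > 0" "\<And>n P. poly_mod \<int> n P \<Longrightarrow> (\<forall>t. 0 \<le> P t \<and> P t \<le> 1 / 2) \<Longrightarrow> period_mod1 (Q n) P"
    using half_range_periodic by metis
  define C where "C n = (fact n)\<^sup>2 * real (Q n) * 2 ^ (n ^ 2 + n ^ 3)" for n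
  have C1: "C n \<ge> 1" for n
  proof -
    have "1 \<le> fact n * fact n * Q n * 2 ^ (n ^ 2 + n ^ 3)" using Q(1)[of n] by (simp add: Suc_le_eq)
    then have "real 1 \<le> real (fact n * fact n * Q n * 2 ^ (n ^ 2 + n ^ 3))" by (simp only: of_nat_le_iff)
    then show ?thesis by (simp add: C_def power2_eq_square)
  qed
  show ?thesis
  proof (rule exI[of _ 5], rule exI[of _ C], intro conjI allI impI)
    show "C n > 0" for n using C1[of n] by linarith
    fix F E :: "Z2 set" and l :: int
    assume fin: "finite F" and l: "l \<ge> 1" and E: "periodic (scaled_lattice l) E" and "\<exists>A. tiling F A E"
    then obtain A where A: "\<And>x. (\<Sum>f\<in>F. indicator A (x - f)) = (indicator E x :: real)"
      using tiling_iff by metis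
    have perE: "has_period (l \<odot> z) (indicator E :: Z2 \<Rightarrow> real)" for z using E by (simp add: periodic_iff)
    show "\<exists>M A'. M > 0 \<and> tiling F A' E \<and> periodic (scaled_lattice (l * M)) A' \<and>
        real_of_int M \<le> (if card F \<le> 1 then C (card F) else C (card F) * diam F powr (5 * real (card F) ^ 4))"
    proof (cases "card F \<le> 1")
      case True
      then obtain A' where "\<And>z. has_period (l \<odot> z) (indicator A' :: Z2 \<Rightarrow> real)"
        "\<And>x. (\<Sum>f\<in>F. indicator A' (x - f)) = (indicator E x :: real)"
        using tiling_small[OF fin _ A perE] by blast
      then show ?thesis using True C1
        by (intro exI[of _ 1] exI[of _ A']) (simp add: tiling_iff[OF fin] periodic_iff)
    next
      case False
      define n where "n = card F"
      obtain f0 where f0: "f0 \<in> F" using False by fastforce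
      obtain U A' where U: "finite U" "0 \<notin> U" "card U \<le> card F"
        "\<And>w. w \<in> U \<Longrightarrow> \<exists>f\<in>F - {f0}. w = (\<Prod>g\<in>F - {f0} - {f}. coord (g - f0)) \<odot> (f - f0)"
        and A': "\<And>x. (\<Sum>f\<in>F. indicator A' (x - f)) = (indicator E x :: real)"
        "\<And>z. has_period ((l * total_period (Q n) (card F) F U) \<odot> z) (indicator A' :: Z2 \<Rightarrow> real)"
        by (rule periodic_tiling[OF fin f0 _ A perE Q(2)]) (use l Q(1) in \<open>auto simp: n_def\<close>)
      define M where "M = total_period (Q n) n F U"
      have "(\<Prod>w\<in>U. \<bar>coord w\<bar>) > 0" using U(2) coord_nonzero by (intro prod_pos) (metis zero_less_abs_iff)
      then have Mpos: "M > 0"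
        unfolding M_def total_period_def using Q(1)[of n] \<open>(\<Prod>w\<in>U. \<bar>coord w\<bar>) > 0\<close>
        by (intro mult_pos_pos) (simp_all add: prod_pos nz_pos)
      have D: "1 \<le> diam F" using diam_ge_1[OF fin] False by simp
      have "real_of_int M \<le> C n * diam F ^ (5 * n ^ 4)"
        using total_period_le[OF fin U(1,3) n_def[symmetric] D _ f0 U(4), of "int (Q n)"]
          diff_le_diam[OF fin] Q(1)[of n] by (simp add: M_def C_def)
      also have "diam F ^ (5 * n ^ 4) = diam F powr (5 * real n ^ 4)"
        using D powr_realpow[of "diam F" "5 * n ^ 4"] by simp
      finally have "real_of_int M \<le> C n * diam F powr (5 * real n ^ 4)" .
      then show ?thesis using False Mpos A'
        by (intro exI[of _ M] exI[of _ A']) (simp add: tiling_iff[OF fin] periodic_iff M_def n_def)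
    qed
  qed simp
qed

end
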